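(* Let $\ell$ be a prime and let $K/\mathbb{Q}$ be a Galois extension of degree $\ell^3$ with $\mathrm{Gal}(K/\mathbb{Q})\simeq C_\ell\times C_\ell\times C_\ell$. Then for every prime $p$ and every integer $b\ge 1$, $a_{p^{b\ell}}(K)\neq 0$.
   Context: For a number field $K$ with ring of integers $\mathcal{O}_K$, $a_n(K)$ denotes the number of nonzero ideals $\mathfrak{a}\subset\mathcal{O}_K$ with $[\mathcal{O}_K:\mathfrak{a}]=n$, i.e. the $n$-th coefficient of the Dedekind zeta function $\zeta_K(s)=\sum_{n\ge1}a_n(K)n^{-s}$. $C_\ell$ denotes the cyclic group of order $\ell$. *)

theory Defs
  imports
    "HOL-Algebra.Algebraic_Closure_Type"
    "HOL-Algebra.Elementary_Groups"
    "HOL-Algebra.QuotRing"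
begin

text \<open>
  A number field is given as a type of class \<^class>\<open>field_char_0\<close> (the field being all of the
  type) that is finite-dimensional over the rationals, which embed through \<^const>\<open>of_rat\<close> with
  image \<^const>\<open>Rats\<close>. The type is passed as an argument \<open>TYPE('k)\<close>.
\<close>

interpretation rat_vs: vector_space "\<lambda>(q :: rat) (x :: 'k :: field_char_0). of_rat q * x"
  by unfold_locales (simp_all add: algebra_simps of_rat_add of_rat_mult)

definition number_field :: "'k::field_char_0 itself \<Rightarrow> bool" where
  "number_field _ \<longleftrightarrow> (\<exists>B :: 'k set. finite B \<and> rat_vs.span B = UNIV)"

definition degree_over_rat :: "'k::field_char_0 itself \<Rightarrow> nat" where
  "degree_over_rat _ = rat_vs.dim (UNIV :: 'k set)"

definition galois_group :: "'k::field_char_0 itself \<Rightarrow> ('k \<Rightarrow> 'k) monoid" where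
  "galois_group _ =
     \<lparr>carrier = {\<sigma> \<in> ring_iso ring_of_type_algebra ring_of_type_algebra. \<forall>q\<in>\<rat>. \<sigma> q = q},
      monoid.mult = (\<circ>), one = id\<rparr>"

text \<open>For number fields (so that the extension is finite): the fixed field of the group of
  automorphisms is the base field.\<close>

definition galois_over_rat :: "'k::field_char_0 itself \<Rightarrow> bool" where
  "galois_over_rat K \<longleftrightarrow>
     number_field K \<and> {x. \<forall>\<sigma>\<in>carrier (galois_group K). \<sigma> x = x} = \<rat>"

definition ring_of_integers :: "'k::field_char_0 itself \<Rightarrow> 'k ring" where
  "ring_of_integers _ = ring_of_type_algebra\<lparr>carrier := {x. algebraic_int x}\<rparr>"

text \<open>
  Both uses of \<^const>\<open>card\<close> below are over finite sets when \<open>'k\<close> is a number field and \<open>n > 0\<close>: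
  nonzero ideals have finite index, and there are only finitely many of each index. An infinite
  index would be recorded as \<open>0\<close>, so it is never counted for \<open>n > 0\<close>.
\<close>

definition ideal_index :: "'k::field_char_0 itself \<Rightarrow> 'k set \<Rightarrow> nat" where
  "ideal_index K I = card (carrier (ring_of_integers K Quot I))"

definition ideal_count :: "'k::field_char_0 itself \<Rightarrow> nat \<Rightarrow> nat" where
  "ideal_count K n =
     card {I. ideal I (ring_of_integers K) \<and> I \<noteq> {\<zero>\<^bsub>ring_of_integers K\<^esub>} \<and> ideal_index K I = n}"

end

(*
  Let O be the ring of integers and P a maximal ideal above p. Every nonzero class of O/P has a
  representative y with s y = y^p mod P for some Galois element s that maps P into P. As the
  Galois group has exponent l, iterating gives y^(p^l) = y mod P, so |O/P| = p^f with f | l.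

  For any ideal I containing a power of p there is an ideal J inside I with I/J isomorphic to O/P:
  take J maximal among the proper subideals of I containing P I and p^(m+1), where p^m is in I.
  Such J exist since I = P I + p^(m+1) O would, by Nakayama's elimination, give t outside P with
  t I inside p^(m+1) O, hence t p^m in p^(m+1) O and t in p O, a contradiction. Iterating from O
  yields ideals of index p^(f m) for all m, in particular of index p^(b l). Neither Dedekind's
  factorization theorem nor the existence of an integral basis is needed.

  The number of ideals of a given index n is finite because they all contain n!, and O/n! is
  finite: elements of O independent modulo a prime p are linearly independent over the rationals.
*)
theory Submission
  imports Defs "HOL-Algebra.Sylow" "HOL-Number_Theory.Cong" "Jordan_Normal_Form.Char_Poly"
begin

text \<open>The Galois group enters through its exponent: every automorphism s satisfies s^l = id,
  which confines the residue degree to divisors of l although the group has order l^3. The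
  divisibility is read off multiplicatively: a generator of the cyclic unit group of O/P has order
  p^f - 1, and y^(p^l) = y makes this divide p^l - 1, which forces f | l. The obstacle is that no
  single Frobenius automorphism is at hand. The s found for y depends on y and may move P, in which
  case the congruence cannot be iterated. The representative is therefore multiplied by an e
  congruent to 1 modulo P that every automorphism moving P sends into P. Different classes may still
  use different s, which does no harm since all of them share the exponent l. The coefficient is a
  \<open>card\<close>, and \<open>card\<close> is 0 on infinite sets, so a single ideal of the right
  index does not yet make it nonzero. This is why the finiteness of the set of ideals of given index
  has to be shown.\<close>

section \<open>Algebraic integers form a ring\<close>

text \<open>The characteristic polynomial is monic, and its coefficients are integers because
  \<open>A\<close> is the image of an integer matrix \<open>B\<close> under the ring homomorphism
  \<open>of_int\<close>.\<close>

lemma algebraic_int_eigenvalue: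
  fixes x :: "'a :: field_char_0"
  assumes A: "A \<in> carrier_mat n n" and Z: "elements_mat A \<subseteq> \<int>" and ev: "eigenvalue A x"
  shows "algebraic_int x"
proof -
  obtain f :: "'a \<Rightarrow> int" where f: "\<And>z. z \<in> \<int> \<Longrightarrow> z = of_int (f z)"
    by (metis Ints_cases)
  define B where "B = map_mat f A"
  have B: "B \<in> carrier_mat n n" using A by (simp add: B_def)
  have AB: "A = map_mat of_int B"
  proof (intro eq_matI)
    fix i j assume "i < dim_row (map_mat of_int B)" "j < dim_col (map_mat of_int B)"
    then have ij: "i < n" "j < n" using B by auto
    then have "A $$ (i, j) \<in> \<int>" using A Z by (force simp: elements_mat_def)
    then show "A $$ (i, j) = map_mat of_int B $$ (i, j)"
      using ij A f by (simp add: B_def)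
  qed (use A in \<open>auto simp: B_def\<close>)
  have "poly (char_poly A) x = 0" using eigenvalue_root_char_poly[OF A] ev by blast
  moreover have "char_poly A = map_poly of_int (char_poly B)"
    unfolding AB using of_int_hom.char_poly_hom[OF B] .
  moreover have "lead_coeff (char_poly A) = 1"
    using degree_monic_char_poly[OF A] by simp
  ultimately show ?thesis
    by (intro algebraic_int.intros[of "char_poly A"]) auto
qed


text \<open>With integer scalars, \<open>int_mod.span S\<close> is the additive group generated by
  \<open>S\<close>.\<close>

interpretation int_mod: Modules.module "\<lambda>(n :: int) (x :: 'a :: comm_ring_1). of_int n * x"
  by unfold_locales (simp_all add: algebra_simps)

text \<open>The determinant trick: multiplication by \<open>z\<close> is described on the generators
  by an integer matrix, and the vector of generators is an eigenvector for \<open>z\<close>. It is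
  nonzero because of \<open>s0\<close>.\<close>

lemma algebraic_int_if_stabilizes_lattice:
  fixes z :: "'a :: field_char_0"
  assumes S: "finite S" "s0 \<in> S" "s0 \<noteq> 0" and stable: "\<And>s. s \<in> S \<Longrightarrow> z * s \<in> int_mod.span S"
  shows "algebraic_int z"
proof -
  have "\<exists>c. z * s = (\<Sum>t\<in>S. of_int (c t) * t)" if "s \<in> S" for s
    using stable[OF that] S(1) by (auto simp: int_mod.span_finite)
  then obtain c :: "'a \<Rightarrow> 'a \<Rightarrow> int" where
    c: "\<And>s. s \<in> S \<Longrightarrow> z * s = (\<Sum>t\<in>S. of_int (c s t) * t)" by metis
  define N where "N = card S"
  obtain h where h: "bij_betw h {0..<N} S"
    using ex_bij_betw_nat_finite[OF S(1)] unfolding N_def by blast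
  define A :: "'a mat" where "A = mat N N (\<lambda>(i, j). of_int (c (h i) (h j)))"
  define v where "v = vec N h"
  have hS: "h i \<in> S" if "i < N" for i using h that by (auto simp: bij_betw_def)
  obtain i0 where i0: "i0 < N" "h i0 = s0" using h S(2) by (force simp: bij_betw_def)
  have "A *\<^sub>v v = z \<cdot>\<^sub>v v"
  proof (intro eq_vecI)
    fix i assume "i < dim_vec (z \<cdot>\<^sub>v v)"
    then have i: "i < N" by (simp add: v_def)
    have "vec_index (A *\<^sub>v v) i = (\<Sum>j\<in>{0..<N}. of_int (c (h i) (h j)) * h j)"
      using i by (simp add: A_def v_def scalar_prod_def)
    also have "\<dots> = (\<Sum>t\<in>S. of_int (c (h i) t) * t)"
      by (rule sum.reindex_bij_betw[OF h])
    also have "\<dots> = z * h i" using c[OF hS[OF i]] by simp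
    finally show "vec_index (A *\<^sub>v v) i = vec_index (z \<cdot>\<^sub>v v) i" using i by (simp add: v_def)
  qed (simp add: A_def v_def)
  moreover have "v \<noteq> 0\<^sub>v N"
  proof
    assume "v = 0\<^sub>v N"
    then have "vec_index v i0 = 0" using i0 by simp
    then show False using i0 S(3) by (simp add: v_def)
  qed
  ultimately have "eigenvalue A z"
    unfolding eigenvalue_def eigenvector_def by (intro exI[of _ v]) (simp add: A_def v_def)
  moreover have "A \<in> carrier_mat N N" by (simp add: A_def)
  moreover have "elements_mat A \<subseteq> \<int>" by (auto simp: elements_mat_def A_def)
  ultimately show ?thesis by (rule algebraic_int_eigenvalue[rotated 2])
qed

text \<open>A monic polynomial with a root is not constant, hence \<open>m > 0\<close>; this puts
  \<open>1\<close> among the monomials of \<open>algebraic_int_common_lattice\<close>.\<close>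

lemma algebraic_int_power_reduction:
  fixes x :: "'a :: field_char_0"
  assumes "algebraic_int x"
  obtains m and c :: "nat \<Rightarrow> int" where "m > 0" "x ^ m = (\<Sum>k<m. of_int (c k) * x ^ k)"
proof -
  obtain p :: "int poly" where p: "poly (map_poly of_int p) x = 0" "lead_coeff p = 1"
    using assms by (auto simp: algebraic_int_altdef_ipoly)
  define m where "m = degree p"
  have "m > 0"
  proof (rule ccontr)
    assume "\<not> m > 0"
    then obtain a where "p = [:a:]" by (metis m_def degree_eq_zeroE neq0_conv)
    then show False using p by simp
  qed
  moreover have "0 = (\<Sum>k\<le>m. of_int (poly.coeff p k) * x ^ k)"
    using p(1) by (simp add: poly_altdef m_def degree_map_poly coeff_map_poly)
  then have "x ^ m = (\<Sum>k<m. of_int (- poly.coeff p k) * x ^ k)"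
    using p(2) by (simp add: m_def lessThan_Suc_atMost[symmetric] sum_negf eq_neg_iff_add_eq_0 add.commute)
  ultimately show ?thesis by (rule that)
qed

text \<open>The monomials \<open>x ^ i * y ^ j\<close> below the two degrees generate Z[x, y]
  additively; only a top exponent needs the monic relation. The element \<open>1\<close> is the
  nonzero generator that \<open>algebraic_int_if_stabilizes_lattice\<close> asks for.\<close>

lemma algebraic_int_common_lattice:
  fixes x y :: "'a :: field_char_0"
  assumes "algebraic_int x" "algebraic_int y"
  obtains S :: "'a set" where "finite S" "1 \<in> S"
    "\<And>s. s \<in> S \<Longrightarrow> x * s \<in> int_mod.span S" "\<And>s. s \<in> S \<Longrightarrow> y * s \<in> int_mod.span S"
proof -
  obtain m c where m: "m > 0" and c: "x ^ m = (\<Sum>k<m. of_int (c k) * x ^ k)"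
    using algebraic_int_power_reduction[OF assms(1)] .
  obtain n d where n: "n > 0" and d: "y ^ n = (\<Sum>k<n. of_int (d k) * y ^ k)"
    using algebraic_int_power_reduction[OF assms(2)] .
  define S where "S = (\<lambda>(i, j). x ^ i * y ^ j) ` ({..<m} \<times> {..<n})"
  have base: "x ^ i * y ^ j \<in> int_mod.span S" if "i < m" "j < n" for i j
    using that by (intro int_mod.span_base) (auto simp: S_def)
  show ?thesis
  proof
    show "finite S" by (simp add: S_def)
    show "1 \<in> S" using m n by (force simp: S_def intro: image_eqI[of _ _ "(0, 0)"])
    show "x * s \<in> int_mod.span S" if "s \<in> S" for s
    proof -
      obtain i j where ij: "i < m" "j < n" "s = x ^ i * y ^ j" using \<open>s \<in> S\<close> by (auto simp: S_def)
      show ?thesis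
      proof (cases "Suc i = m")
        case True
        have "x * s = x ^ m * y ^ j" using ij by (simp flip: True)
        also have "\<dots> = (\<Sum>k<m. of_int (c k) * (x ^ k * y ^ j))"
          by (simp add: c sum_distrib_right mult.assoc)
        also have "\<dots> \<in> int_mod.span S"
          using ij by (intro int_mod.span_sum int_mod.span_scale base) auto
        finally show ?thesis .
      next
        case False
        then show ?thesis using base[of "Suc i" j] ij by (simp add: mult.assoc)
      qed
    qed
    show "y * s \<in> int_mod.span S" if "s \<in> S" for s
    proof -
      obtain i j where ij: "i < m" "j < n" "s = x ^ i * y ^ j" using \<open>s \<in> S\<close> by (auto simp: S_def)
      show ?thesis
      proof (cases "Suc j = n")
        case True
        have "y * s = x ^ i * y ^ n" using ij by (simp flip: True)
        also have "\<dots> = (\<Sum>k<n. of_int (d k) * (x ^ i * y ^ k))"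
          by (simp add: d sum_distrib_left algebra_simps)
        also have "\<dots> \<in> int_mod.span S"
          using ij by (intro int_mod.span_sum int_mod.span_scale base) auto
        finally show ?thesis .
      next
        case False
        then show ?thesis using base[of i "Suc j"] ij by (simp add: algebra_simps)
      qed
    qed
  qed
qed

lemma int_mod_span_mult:
  assumes "\<And>s. s \<in> S \<Longrightarrow> x * s \<in> int_mod.span S" and "t \<in> int_mod.span S"
  shows "x * t \<in> int_mod.span S"
  using assms(2)
proof (induction rule: int_mod.span_induct_alt)
  case (step n s t)
  have "of_int n * (x * s) + x * t \<in> int_mod.span S"
    using step assms(1) by (intro int_mod.span_add int_mod.span_scale)
  then show ?case by (simp add: algebra_simps)
qed (simp add: int_mod.span_zero)

lemma algebraic_int_add:
  fixes x y :: "'a :: field_char_0"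
  assumes "algebraic_int x" "algebraic_int y"
  shows "algebraic_int (x + y)"
proof -
  obtain S :: "'a set" where S: "finite S" "1 \<in> S"
    "\<And>s. s \<in> S \<Longrightarrow> x * s \<in> int_mod.span S" "\<And>s. s \<in> S \<Longrightarrow> y * s \<in> int_mod.span S"
    using algebraic_int_common_lattice[OF assms] by blast
  show ?thesis
    by (rule algebraic_int_if_stabilizes_lattice[OF S(1,2)])
      (auto simp: distrib_right intro!: int_mod.span_add S)
qed

lemma algebraic_int_mult:
  fixes x y :: "'a :: field_char_0"
  assumes "algebraic_int x" "algebraic_int y"
  shows "algebraic_int (x * y)"
proof -
  obtain S :: "'a set" where S: "finite S" "1 \<in> S"
    "\<And>s. s \<in> S \<Longrightarrow> x * s \<in> int_mod.span S" "\<And>s. s \<in> S \<Longrightarrow> y * s \<in> int_mod.span S"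
    using algebraic_int_common_lattice[OF assms] by blast
  show ?thesis
  proof (rule algebraic_int_if_stabilizes_lattice[OF S(1,2)])
    show "x * y * s \<in> int_mod.span S" if "s \<in> S" for s
      using int_mod_span_mult[OF S(3) S(4)[OF that]] by (simp add: mult.assoc)
  qed simp
qed

lemma algebraic_int_diff:
  fixes x y :: "'a :: field_char_0"
  shows "algebraic_int x \<Longrightarrow> algebraic_int y \<Longrightarrow> algebraic_int (x - y)"
  using algebraic_int_add[of x "- y"] by simp

lemma algebraic_int_power:
  fixes x :: "'a :: field_char_0"
  shows "algebraic_int x \<Longrightarrow> algebraic_int (x ^ n)"
  by (induction n) (simp_all add: algebraic_int_mult)

lemma algebraic_int_sum:
  fixes f :: "'b \<Rightarrow> 'a :: field_char_0"
  shows "(\<And>i. i \<in> A \<Longrightarrow> algebraic_int (f i)) \<Longrightarrow> algebraic_int (sum f A)"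
  by (induction A rule: infinite_finite_induct) (simp_all add: algebraic_int_add)

lemma algebraic_int_prod:
  fixes f :: "'b \<Rightarrow> 'a :: field_char_0"
  shows "(\<And>i. i \<in> A \<Longrightarrow> algebraic_int (f i)) \<Longrightarrow> algebraic_int (prod f A)"
  by (induction A rule: infinite_finite_induct) (simp_all add: algebraic_int_mult)

section \<open>Cosets in abelian groups\<close>

definition add_subgroup :: "'a :: ab_group_add set \<Rightarrow> bool" where
  "add_subgroup I \<longleftrightarrow> 0 \<in> I \<and> (\<forall>x\<in>I. \<forall>y\<in>I. x - y \<in> I)"

text \<open>The order \<open>h + x\<close> is that of right cosets in HOL-Algebra, so
  \<open>cosets alg_ints I\<close> is equal to the carrier of the quotient ring, see
  \<open>carrier_Quot_ring_of_integers\<close>.\<close>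

definition cosets :: "'a :: ab_group_add set \<Rightarrow> 'a set \<Rightarrow> 'a set set" where
  "cosets A I = (\<lambda>x. (\<lambda>h. h + x) ` I) ` A"

lemma add_subgroupD:
  assumes "add_subgroup I"
  shows "0 \<in> I" "x \<in> I \<Longrightarrow> y \<in> I \<Longrightarrow> x - y \<in> I" "x \<in> I \<Longrightarrow> - x \<in> I"
    "x \<in> I \<Longrightarrow> y \<in> I \<Longrightarrow> x + y \<in> I"
proof -
  show 0: "0 \<in> I" and diff: "x \<in> I \<Longrightarrow> y \<in> I \<Longrightarrow> x - y \<in> I" for x y
    using assms by (auto simp: add_subgroup_def)
  show minus: "x \<in> I \<Longrightarrow> - x \<in> I" for x using diff[of 0 x] 0 by simp
  show "x \<in> I \<Longrightarrow> y \<in> I \<Longrightarrow> x + y \<in> I" using diff[of x "- y"] minus[of y] by simp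
qed

lemma mem_coset_iff: "y \<in> (\<lambda>h. h + x) ` I \<longleftrightarrow> y - x \<in> I" for x :: "'a :: ab_group_add"
  by (force simp: image_iff algebra_simps)

lemma coset_eq_iff:
  assumes "add_subgroup I"
  shows "(\<lambda>h. h + x) ` I = (\<lambda>h. h + y) ` I \<longleftrightarrow> x - y \<in> I"
proof
  assume "(\<lambda>h. h + x) ` I = (\<lambda>h. h + y) ` I"
  moreover have "x \<in> (\<lambda>h. h + x) ` I" using add_subgroupD(1)[OF assms] by (simp add: mem_coset_iff)
  ultimately show "x - y \<in> I" by (simp add: mem_coset_iff)
next
  assume xy: "x - y \<in> I"
  show "(\<lambda>h. h + x) ` I = (\<lambda>h. h + y) ` I"
  proof (intro Set.set_eqI)
    fix z
    have "z - y \<in> I" if "z - x \<in> I" using add_subgroupD(4)[OF assms that xy] by simp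
    moreover have "z - x \<in> I" if "z - y \<in> I" using add_subgroupD(2)[OF assms that xy] by simp
    ultimately show "z \<in> (\<lambda>h. h + x) ` I \<longleftrightarrow> z \<in> (\<lambda>h. h + y) ` I"
      by (auto simp: mem_coset_iff)
  qed
qed

lemma coset_mem_cosets: "x \<in> A \<Longrightarrow> (\<lambda>h. h + x) ` I \<in> cosets A I"
  by (simp add: cosets_def)

lemma cosets_self:
  assumes "add_subgroup A"
  shows "cosets A A = {A}"
proof -
  have "(\<lambda>h. h + x) ` A = A" if "x \<in> A" for x
    using coset_eq_iff[OF assms, of x 0] that by simp
  then show ?thesis using add_subgroupD(1)[OF assms] by (auto simp: cosets_def image_iff)
qed

text \<open>A set-level isomorphism theorem: maps that identify the same pairs have equinumerous
  images. It will compare O/P with I/J.\<close>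

lemma bij_betw_image_of_kernel:
  assumes "\<And>x y. x \<in> A \<Longrightarrow> y \<in> A \<Longrightarrow> f x = f y \<longleftrightarrow> g x = g y"
  shows "\<exists>\<phi>. bij_betw \<phi> (f ` A) (g ` A)"
proof
  let ?\<phi> = "\<lambda>z. g (SOME x. x \<in> A \<and> f x = z)"
  have *: "?\<phi> (f x) = g x" if "x \<in> A" for x
  proof -
    let ?x = "SOME y. y \<in> A \<and> f y = f x"
    have "?x \<in> A \<and> f ?x = f x" by (rule someI[of _ x]) (simp add: that)
    then show ?thesis using assms that by blast
  qed
  show "bij_betw ?\<phi> (f ` A) (g ` A)"
    unfolding bij_betw_def inj_on_def using * assms by (auto simp: image_image)
qed

text \<open>After choosing a representative \<open>r C\<close> of each coset \<open>C\<close> of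
  \<open>I\<close>, a pair \<open>(C, D)\<close> is sent to the coset \<open>D\<close> translated by
  \<open>r C\<close>.\<close>

lemma card_cosets_tower:
  assumes J: "add_subgroup J" and I: "add_subgroup I" and A: "add_subgroup A"
    and sub: "J \<subseteq> I" "I \<subseteq> A"
    and fin: "finite (cosets A I)" "finite (cosets I J)"
  shows "finite (cosets A J)" "card (cosets A J) = card (cosets A I) * card (cosets I J)"
proof -
  define r where "r C = (SOME x. x \<in> C)" for C :: "'a set"
  have r: "r ((\<lambda>h. h + x) ` I) - x \<in> I" for x
  proof -
    have "x \<in> (\<lambda>h. h + x) ` I" using add_subgroupD(1)[OF I] by (simp add: mem_coset_iff)
    then have "r ((\<lambda>h. h + x) ` I) \<in> (\<lambda>h. h + x) ` I" unfolding r_def by (rule someI)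
    then show ?thesis by (simp add: mem_coset_iff)
  qed
  define \<phi> where "\<phi> = (\<lambda>(C, D). (\<lambda>h. h + r C) ` D)"
  have \<phi>: "\<phi> ((\<lambda>h. h + x) ` I, (\<lambda>h. h + y) ` J) = (\<lambda>h. h + (y + r ((\<lambda>h. h + x) ` I))) ` J" for x y
    by (simp add: \<phi>_def image_image add.assoc)
  have "bij_betw \<phi> (cosets A I \<times> cosets I J) (cosets A J)"
  proof (rule bij_betwI')
    fix p q assume "p \<in> cosets A I \<times> cosets I J" "q \<in> cosets A I \<times> cosets I J"
    then obtain x y x' y' where p: "p = ((\<lambda>h. h + x) ` I, (\<lambda>h. h + y) ` J)"
        and q: "q = ((\<lambda>h. h + x') ` I, (\<lambda>h. h + y') ` J)" and y: "y \<in> I" "y' \<in> I"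
      by (auto simp: cosets_def)
    let ?r = "r ((\<lambda>h. h + x) ` I)" and ?r' = "r ((\<lambda>h. h + x') ` I)"
    have "p = q" if "\<phi> p = \<phi> q"
    proof -
      have J1: "(y + ?r) - (y' + ?r') \<in> J"
        using that by (simp only: p q \<phi> coset_eq_iff[OF J])
      then have "((y + ?r) - (y' + ?r')) - (y - y') \<in> I"
        using sub(1) y by (intro add_subgroupD(2)[OF I, of "(y + ?r) - (y' + ?r')"]) (auto intro: add_subgroupD(2)[OF I])
      then have rr: "?r - ?r' \<in> I" by (simp add: algebra_simps)
      have "(?r' - x') - (?r - x) + (?r - ?r') \<in> I"
        by (rule add_subgroupD(4)[OF I add_subgroupD(2)[OF I r r] rr])
      then have "x - x' \<in> I" by (simp add: algebra_simps)
      then have "(\<lambda>h. h + x) ` I = (\<lambda>h. h + x') ` I" by (simp add: coset_eq_iff[OF I])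
      \<comment> \<open>The two cosets of \<open>I\<close> are now equal, so their chosen
        representatives are the same element and cancel in \<open>J1\<close>.\<close>
      moreover from this have "y - y' \<in> J" using J1 by simp
      ultimately show ?thesis unfolding p q by (simp add: coset_eq_iff[OF J])
    qed
    then show "\<phi> p = \<phi> q \<longleftrightarrow> p = q" by auto
  next
    fix p assume "p \<in> cosets A I \<times> cosets I J"
    then obtain x y where p: "p = ((\<lambda>h. h + x) ` I, (\<lambda>h. h + y) ` J)" and xy: "x \<in> A" "y \<in> I"
      by (auto simp: cosets_def)
    have "(r ((\<lambda>h. h + x) ` I) - x) + x \<in> A"
      using r[of x] sub xy by (intro add_subgroupD(4)[OF A]) auto
    then have "y + r ((\<lambda>h. h + x) ` I) \<in> A"
      using sub xy by (intro add_subgroupD(4)[OF A]) auto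
    then show "\<phi> p \<in> cosets A J" unfolding p \<phi> by (rule coset_mem_cosets)
  next
    fix D assume "D \<in> cosets A J"
    then obtain x where x: "x \<in> A" "D = (\<lambda>h. h + x) ` J" by (auto simp: cosets_def)
    let ?y = "x - r ((\<lambda>h. h + x) ` I)"
    have "?y \<in> I" using add_subgroupD(3)[OF I r[of x]] by simp
    then have "((\<lambda>h. h + x) ` I, (\<lambda>h. h + ?y) ` J) \<in> cosets A I \<times> cosets I J"
      using x by (simp add: cosets_def)
    moreover have "D = \<phi> ((\<lambda>h. h + x) ` I, (\<lambda>h. h + ?y) ` J)"
      unfolding \<phi> x by simp
    ultimately show "\<exists>p\<in>cosets A I \<times> cosets I J. D = \<phi> p" by blast
  qed
  from bij_betw_finite[OF this] bij_betw_same_card[OF this]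
  show "finite (cosets A J)" "card (cosets A J) = card (cosets A I) * card (cosets I J)"
    using fin by (simp_all add: card_cartesian_product)
qed

text \<open>Adding \<open>I\<close> to a coset of \<open>J\<close> gives the coset of
  \<open>I\<close> around it, and this map is onto \<open>cosets A I\<close>.\<close>

lemma finite_cosets_mono:
  assumes "add_subgroup J" "add_subgroup I" "J \<subseteq> I" "finite (cosets A J)"
  shows "finite (cosets A I)"
proof -
  have "(\<lambda>h. h + x) ` I = (\<Union>h\<in>I. (\<lambda>c. h + c) ` ((\<lambda>h. h + x) ` J))" for x
  proof (intro Set.set_eqI iffI)
    fix z assume "z \<in> (\<lambda>h. h + x) ` I"
    then obtain h where "h \<in> I" "z = h + (0 + x)" by auto
    then show "z \<in> (\<Union>h\<in>I. (\<lambda>c. h + c) ` ((\<lambda>h. h + x) ` J))"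
      using add_subgroupD(1)[OF assms(1)] by blast
  next
    fix z assume "z \<in> (\<Union>h\<in>I. (\<lambda>c. h + c) ` ((\<lambda>h. h + x) ` J))"
    then obtain h j where "h \<in> I" "j \<in> J" "z = (h + j) + x" by (auto simp: add.assoc)
    then show "z \<in> (\<lambda>h. h + x) ` I"
      using add_subgroupD(4)[OF assms(2)] assms(3) by (intro image_eqI[of _ _ "h + j"]) auto
  qed
  then have "cosets A I = (\<lambda>C. \<Union>h\<in>I. (\<lambda>c. h + c) ` C) ` cosets A J"
    by (simp add: cosets_def image_image)
  then show ?thesis using assms(4) by simp
qed

section \<open>Finiteness of the ring of integers modulo n\<close>

abbreviation alg_ints :: "'a :: field set" where
  "alg_ints \<equiv> {x. algebraic_int x}"

definition multiples :: "nat \<Rightarrow> 'a :: field set" where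
  "multiples n = (\<lambda>x. of_nat n * x) ` alg_ints"

lemma multiples_iff: "y \<in> multiples n \<longleftrightarrow> (\<exists>x. algebraic_int x \<and> y = of_nat n * x)"
  by (auto simp: multiples_def)

lemma of_nat_mult_mem_multiples: "algebraic_int x \<Longrightarrow> of_nat n * x \<in> multiples n"
  by (auto simp: multiples_iff)

lemma add_subgroup_alg_ints: "add_subgroup (alg_ints :: 'a :: field_char_0 set)"
  by (auto simp: add_subgroup_def algebraic_int_diff)

lemma add_subgroup_multiples: "add_subgroup (multiples n :: 'a :: field_char_0 set)"
  unfolding add_subgroup_def
proof (intro conjI ballI)
  show "(0 :: 'a) \<in> multiples n" by (auto simp: multiples_iff intro: exI[of _ 0])
  fix x y :: 'a assume "x \<in> multiples n" "y \<in> multiples n"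
  then obtain x' y' where "algebraic_int x'" "algebraic_int y'" "x = of_nat n * x'" "y = of_nat n * y'"
    by (auto simp: multiples_iff)
  then show "x - y \<in> multiples n"
    by (auto simp: multiples_iff right_diff_distrib intro!: exI[of _ "x' - y'"] algebraic_int_diff)
qed

lemma mult_mem_multiples:
  fixes a :: "'a :: field_char_0"
  assumes "algebraic_int a" "x \<in> multiples n"
  shows "a * x \<in> multiples n"
proof -
  obtain x' where "algebraic_int x'" "x = of_nat n * x'" using assms(2) by (auto simp: multiples_iff)
  then show ?thesis using assms(1)
    by (auto simp: multiples_iff mult.left_commute intro!: exI[of _ "a * x'"] algebraic_int_mult)
qed

lemma common_denominator:
  fixes u :: "'a \<Rightarrow> rat"
  assumes "finite S"
  shows "\<exists>D :: int. D > 0 \<and> (\<forall>s\<in>S. of_int D * u s \<in> \<int>)"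
  using assms
proof (induction S)
  case (insert s S)
  then obtain D :: int where D: "D > 0" "\<And>t. t \<in> S \<Longrightarrow> of_int D * u t \<in> \<int>" by auto
  obtain a b where ab: "quotient_of (u s) = (a, b)" by fastforce
  then have b: "b > 0" "u s = of_int a / of_int b"
    using quotient_of_denom_pos quotient_of_div by auto
  have "of_int (b * D) * u t \<in> \<int>" if t: "t \<in> insert s S" for t
  proof (cases "t = s")
    case True
    have "of_int (b * D) * u t = of_int (D * a)" using b by (simp add: True)
    then show ?thesis by (metis Ints_of_int)
  next
    case False
    then have "t \<in> S" using t by simp
    then have "of_int b * (of_int D * u t) \<in> \<int>" by (intro Ints_mult[OF Ints_of_int] D(2))
    then show ?thesis by (simp only: of_int_mult mult.assoc)
  qed
  moreover have "b * D > 0" using D(1) b(1) by simp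
  ultimately show ?case by blast
qed (auto intro: exI[of _ 1])

text \<open>For prime \<open>p\<close> this is linear independence over the field with
  \<open>p\<close> elements in O/pO, phrased with integer coefficients so that no quotient space has
  to be built.\<close>

definition independent_mod :: "nat \<Rightarrow> 'a :: field_char_0 set \<Rightarrow> bool" where
  "independent_mod p S \<longleftrightarrow> finite S \<and> S \<subseteq> alg_ints \<and>
     (\<forall>c :: 'a \<Rightarrow> int. (\<Sum>s\<in>S. of_int (c s) * s) \<in> multiples p \<longrightarrow> (\<forall>s\<in>S. int p dvd c s))"

text \<open>In an integral relation all coefficients are divisible by \<open>p\<close>; dividing by \<open>p\<close> gives another
  relation, so they are divisible by every power of \<open>p\<close> and vanish.\<close>

lemma independent_mod_imp_independent:
  fixes S :: "'a :: field_char_0 set"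
  assumes S: "independent_mod p S" and p: "p > 1"
  shows "rat_vs.independent S"
proof
  have fin: "finite S" using S by (simp add: independent_mod_def)
  have dvd: "\<forall>s\<in>S. int p ^ n dvd c s" if "(\<Sum>s\<in>S. of_int (c s) * s) = 0" for n and c :: "'a \<Rightarrow> int"
    using that
  proof (induction n arbitrary: c)
    case (Suc n)
    have "(\<Sum>s\<in>S. of_int (c s) * s) \<in> multiples p"
      using add_subgroupD(1)[OF add_subgroup_multiples] by (simp only: Suc.prems)
    then have "\<forall>s\<in>S. int p dvd c s"
      using S unfolding independent_mod_def by blast
    then have "\<forall>s\<in>S. \<exists>k. c s = int p * k" by (auto elim: dvdE)
    then obtain d where c: "\<And>s. s \<in> S \<Longrightarrow> c s = int p * d s" by metis
    have "(\<Sum>s\<in>S. of_int (c s) * s) = of_nat p * (\<Sum>s\<in>S. of_int (d s) * s)"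
      by (simp add: sum_distrib_left c mult.assoc)
    then have "(\<Sum>s\<in>S. of_int (d s) * s) = 0" using Suc.prems p by simp
    from Suc.IH[OF this] show ?case using c by simp
  qed simp
  assume "rat_vs.dependent S"
  then obtain u s where s: "s \<in> S" "u s \<noteq> 0" and u: "(\<Sum>s\<in>S. of_rat (u s) * s) = 0"
    using fin by (auto simp: rat_vs.dependent_finite)
  obtain D :: int where D: "D > 0" "\<And>s. s \<in> S \<Longrightarrow> of_int D * u s \<in> \<int>"
    using common_denominator[OF fin] by blast
  define c where "c s = \<lfloor>of_int D * u s\<rfloor>" for s
  have c: "rat_of_int (c s) = of_int D * u s" if "s \<in> S" for s
    unfolding c_def using D(2)[OF that] by (metis Ints_cases floor_of_int)
  have "(of_int (c s) :: 'a) = of_int D * of_rat (u s)" if "s \<in> S" for s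
    using arg_cong[OF c[OF that], of "of_rat :: rat \<Rightarrow> 'a"] by (simp add: of_rat_mult)
  then have "(\<Sum>s\<in>S. of_int (c s) * s) = of_int D * (\<Sum>s\<in>S. of_rat (u s) * s)"
    by (simp add: sum_distrib_left mult.assoc)
  then have "(\<Sum>s\<in>S. of_int (c s) * s) = 0" using u by simp
  \<comment> \<open>The exponent is chosen so that size gives the contradiction: a nonzero
    \<open>c s\<close> divisible by that power of \<open>p\<close> would be at least
    \<open>p ^ nat \<bar>c s\<bar>\<close>, but \<open>p ^ k > k\<close>.\<close>
  from dvd[OF this, of "nat \<bar>c s\<bar>"] s have "int p ^ nat \<bar>c s\<bar> dvd c s" by blast
  moreover have "c s \<noteq> 0" using c[OF s(1)] D(1) s(2) by auto
  ultimately have "int p ^ nat \<bar>c s\<bar> \<le> \<bar>c s\<bar>"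
    using dvd_imp_le_int[of "c s" "int p ^ nat \<bar>c s\<bar>"] by simp
  then have "p ^ nat \<bar>c s\<bar> \<le> nat \<bar>c s\<bar>"
    by (simp add: le_nat_iff)
  moreover have "nat \<bar>c s\<bar> < p ^ nat \<bar>c s\<bar>" using p by (simp add: power_gt_expt)
  ultimately show False by simp
qed

text \<open>Independent sets modulo \<open>p\<close> have at most \<open>card B\<close> elements, so
  there is a largest one. It spans O/pO, and coefficients in \<open>{0..<int p}\<close>
  suffice.\<close>

lemma finite_cosets_multiples_prime:
  assumes K: "number_field TYPE('k :: field_char_0)" and p: "prime p"
  shows "finite (cosets (alg_ints :: 'k set) (multiples p))"
proof -
  obtain B :: "'k set" where B: "finite B" "rat_vs.span B = UNIV"
    using K by (auto simp: number_field_def)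
  have bound: "card S \<le> card B" if "independent_mod p S" for S :: "'k set"
    using rat_vs.independent_span_bound[OF B(1) independent_mod_imp_independent[OF that]] B(2)
      prime_gt_1_nat[OF p] by simp
  have "independent_mod p ({} :: 'k set)" by (simp add: independent_mod_def)
  then obtain S :: "'k set" where S: "independent_mod p S"
      and max: "\<And>T :: 'k set. independent_mod p T \<Longrightarrow> card T \<le> card S"
    using ex_has_greatest_nat[of "independent_mod p" "{} :: 'k set" card "Suc (card B)"] bound
    by (meson le_imp_less_Suc)
  have fin: "finite S" and SO: "S \<subseteq> alg_ints" using S by (auto simp: independent_mod_def)
  have alg: "algebraic_int (\<Sum>s\<in>S. of_int (c s) * s)" for c :: "'k \<Rightarrow> int"
    using SO by (intro algebraic_int_sum algebraic_int_mult) auto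
  have spans: "\<exists>c :: 'k \<Rightarrow> int. x - (\<Sum>s\<in>S. of_int (c s) * s) \<in> multiples p"
    if x: "algebraic_int x" for x :: 'k
  proof (cases "x \<in> S")
    case True
    have "(\<Sum>s\<in>S. of_int (if s = x then 1 else 0) * s) = (\<Sum>s\<in>S. if s = x then s else 0)"
      by (intro sum.cong) auto
    also have "\<dots> = x" using True fin by simp
    finally show ?thesis
      using add_subgroupD(1)[OF add_subgroup_multiples[of p]]
      by (intro exI[of _ "\<lambda>s. if s = x then 1 else 0"]) simp
  next
    case False
    then have "\<not> independent_mod p (insert x S)" using max[of "insert x S"] fin by auto
    then obtain c :: "'k \<Rightarrow> int" where
      c: "of_int (c x) * x + (\<Sum>s\<in>S. of_int (c s) * s) \<in> multiples p" "\<not> (\<forall>s\<in>insert x S. int p dvd c s)"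
      using fin SO x False by (auto simp: independent_mod_def)
    \<comment> \<open>Otherwise the \<open>x\<close> term already lies in
      \<open>multiples p\<close>, and independence of \<open>S\<close> makes \<open>p\<close> divide
      all the other coefficients as well. Thus \<open>c x\<close> is invertible modulo
      \<open>p\<close>, and Bezout solves the relation for \<open>x\<close>.\<close>
    have "\<not> int p dvd c x"
    proof
      assume "int p dvd c x"
      then obtain k where "c x = int p * k" ..
      then have "of_int (c x) * x \<in> multiples p"
        using x by (auto simp: multiples_iff mult.assoc intro!: exI[of _ "of_int k * x"] algebraic_int_mult)
      from add_subgroupD(2)[OF add_subgroup_multiples c(1) this]
      have "\<forall>s\<in>S. int p dvd c s" using S by (simp add: independent_mod_def)
      with \<open>int p dvd c x\<close> c(2) show False by blast
    qed
    then have "Rings.coprime (int p) (c x)" using p by (intro prime_imp_coprime) auto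
    then obtain a b where ab: "a * int p + b * c x = 1" using bezout_int[of "int p" "c x"] by auto
    have "x - (\<Sum>s\<in>S. of_int (- b * c s) * s)
        = of_nat p * (of_int a * x) + of_int b * (of_int (c x) * x + (\<Sum>s\<in>S. of_int (c s) * s))"
    proof -
      let ?R = "\<Sum>s\<in>S. of_int (c s) * s"
      have eq: "(of_int a * of_nat p + of_int b * of_int (c x)) * x = x"
        using arg_cong[OF ab, of "of_int :: int \<Rightarrow> 'k"]
        by (simp only: of_int_add of_int_mult of_int_1 of_int_of_nat_eq mult_1_left)
      have "(\<Sum>s\<in>S. of_int (- b * c s) * s) = of_int (- b) * ?R"
        by (simp only: sum_distrib_left mult.assoc of_int_mult)
      then have "x - (\<Sum>s\<in>S. of_int (- b * c s) * s)
          = (of_int a * of_nat p + of_int b * of_int (c x)) * x + of_int b * ?R"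
        unfolding eq by simp
      also have "\<dots> = of_nat p * (of_int a * x) + of_int b * (of_int (c x) * x + ?R)"
        by (simp add: algebra_simps)
      finally show ?thesis .
    qed
    also have "\<dots> \<in> multiples p"
      by (intro add_subgroupD(4)[OF add_subgroup_multiples of_nat_mult_mem_multiples
            mult_mem_multiples[OF algebraic_int_of_int c(1)]] algebraic_int_mult algebraic_int_of_int x)
    finally show ?thesis by (rule exI[where x = "\<lambda>s. - b * c s"])
  qed
  have "cosets (alg_ints :: 'k set) (multiples p) \<subseteq>
    (\<lambda>c. (\<lambda>h. h + (\<Sum>s\<in>S. of_int (c s) * s)) ` multiples p) ` (S \<rightarrow>\<^sub>E {0..<int p})"
  proof
    fix C :: "'k set" assume "C \<in> cosets alg_ints (multiples p)"
    then obtain x where x: "algebraic_int x" "C = (\<lambda>h. h + x) ` multiples p" by (auto simp: cosets_def)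
    obtain c :: "'k \<Rightarrow> int" where c: "x - (\<Sum>s\<in>S. of_int (c s) * s) \<in> multiples p"
      using spans[OF x(1)] by blast
    \<comment> \<open>Reducing the coefficients changes the sum by an element of
      \<open>multiples p\<close>; restricting the function to \<open>S\<close> puts it in a finite
      function space.\<close>
    define d where "d = (\<lambda>s\<in>S. c s mod int p)"
    have "x - (\<Sum>s\<in>S. of_int (d s) * s) = (x - (\<Sum>s\<in>S. of_int (c s) * s))
        + of_nat p * (\<Sum>s\<in>S. of_int (c s div int p) * s)"
    proof -
      have "(\<Sum>s\<in>S. of_int (c s) * s) = (\<Sum>s\<in>S. of_nat p * (of_int (c s div int p) * s) + of_int (d s) * s)"
      proof (intro sum.cong refl)
        fix s assume s: "s \<in> S"
        have eq: "of_int (c s) = of_nat p * of_int (c s div int p) + (of_int (c s mod int p) :: 'k)"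
          by (metis mult_div_mod_eq of_int_add of_int_mult of_int_of_nat_eq)
        show "of_int (c s) * s = of_nat p * (of_int (c s div int p) * s) + of_int (d s) * s"
          using s unfolding eq by (simp add: d_def distrib_right mult.assoc)
      qed
      then show ?thesis by (simp add: sum.distrib sum_distrib_left)
    qed
    also have "\<dots> \<in> multiples p"
      by (intro add_subgroupD(4)[OF add_subgroup_multiples c of_nat_mult_mem_multiples] alg)
    finally have "C = (\<lambda>h. h + (\<Sum>s\<in>S. of_int (d s) * s)) ` multiples p"
      using x(2) by (simp add: coset_eq_iff[OF add_subgroup_multiples])
    moreover have "d \<in> S \<rightarrow>\<^sub>E {0..<int p}" using prime_gt_0_nat[OF p] by (auto simp: d_def)
    ultimately show "C \<in> (\<lambda>c. (\<lambda>h. h + (\<Sum>s\<in>S. of_int (c s) * s)) ` multiples p) ` (S \<rightarrow>\<^sub>E {0..<int p})"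
      by blast
  qed
  moreover have "finite (S \<rightarrow>\<^sub>E {0..<int p})" using fin by (intro finite_PiE) auto
  ultimately show ?thesis by (meson finite_surj)
qed

text \<open>Split off a prime, n = m p, and use the tower from O over mO to nO: multiplication by m
  carries the cosets of pO in O to those of nO in mO.\<close>

lemma finite_cosets_multiples:
  assumes K: "number_field TYPE('k :: field_char_0)" and n: "n > 0"
  shows "finite (cosets (alg_ints :: 'k set) (multiples n))"
  using n
proof (induction n rule: less_induct)
  case (less n)
  show ?case
  proof (cases "n = 1")
    case True
    show ?thesis using True cosets_self[OF add_subgroup_alg_ints[where 'a = 'k]] by (simp add: multiples_def)
  next
    case False
    then obtain p where p: "prime p" "p dvd n" using prime_factor_nat by blast
    then obtain m where m: "n = m * p" by (metis dvd_def mult.commute)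
    have m0: "m > 0" "m < n" using less.prems m prime_gt_1_nat[OF p(1)] by auto
    let ?s = "\<lambda>x :: 'k. of_nat m * x"
    have mul: "multiples m = ?s ` alg_ints" "multiples n = ?s ` multiples p"
      by (simp_all add: multiples_def image_image m mult.assoc)
    have "(\<lambda>h. h + ?s x) ` ?s ` multiples p = ?s ` ((\<lambda>h. h + x) ` multiples p)" for x
      by (simp add: image_image distrib_left)
    then have "cosets (multiples m :: 'k set) (multiples n) = (`) ?s ` cosets alg_ints (multiples p)"
      unfolding mul cosets_def by (simp add: image_image)
    then have "finite (cosets (multiples m :: 'k set) (multiples n))"
      using finite_cosets_multiples_prime[OF K p(1)] by simp
    moreover have "(multiples m :: 'k set) \<subseteq> alg_ints"
      by (auto simp: multiples_iff intro!: algebraic_int_mult)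
    moreover have "(multiples n :: 'k set) \<subseteq> multiples m"
    proof
      fix y :: 'k assume "y \<in> multiples n"
      then obtain x where "algebraic_int x" "y = of_nat m * (of_nat p * x)"
        by (auto simp: multiples_iff m mult.assoc)
      then show "y \<in> multiples m" by (simp add: of_nat_mult_mem_multiples algebraic_int_mult)
    qed
    ultimately show ?thesis
      using card_cosets_tower(1)[OF add_subgroup_multiples add_subgroup_multiples
          add_subgroup_alg_ints _ _ less.IH[OF m0(2,1)]] by blast
  qed
qed

section \<open>Ideals\<close>

text \<open>Ideals of the ring of integers in terms of the type-class operations;
  \<open>ideal_ring_of_integers_iff\<close> identifies them with the \<open>ideal\<close> of the
  final statement.\<close>

definition alg_ideal :: "'a :: field_char_0 set \<Rightarrow> bool" where
  "alg_ideal I \<longleftrightarrow> I \<subseteq> alg_ints \<and> add_subgroup I \<and> (\<forall>a x. algebraic_int a \<longrightarrow> x \<in> I \<longrightarrow> a * x \<in> I)"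

lemma alg_idealD:
  assumes "alg_ideal I"
  shows "x \<in> I \<Longrightarrow> algebraic_int x" "I \<subseteq> alg_ints" "add_subgroup I" "algebraic_int a \<Longrightarrow> x \<in> I \<Longrightarrow> a * x \<in> I"
    "0 \<in> I" "x \<in> I \<Longrightarrow> y \<in> I \<Longrightarrow> x - y \<in> I" "x \<in> I \<Longrightarrow> y \<in> I \<Longrightarrow> x + y \<in> I"
  using assms add_subgroupD[of I] by (auto simp: alg_ideal_def)

lemma alg_ideal_alg_ints: "alg_ideal (alg_ints :: 'a :: field_char_0 set)"
  by (simp add: alg_ideal_def add_subgroup_alg_ints algebraic_int_mult)

lemma alg_ideal_multiples: "alg_ideal (multiples n :: 'a :: field_char_0 set)"
proof -
  have "multiples n \<subseteq> (alg_ints :: 'a set)"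
    unfolding multiples_def using algebraic_int_mult[OF algebraic_int_of_nat] by blast
  then show ?thesis
    unfolding alg_ideal_def using add_subgroup_multiples mult_mem_multiples by blast
qed

lemma multiples_subset_ideal:
  assumes "alg_ideal I" "of_nat n \<in> I"
  shows "multiples n \<subseteq> I"
  using alg_idealD(4)[OF assms(1) _ assms(2)] by (auto simp: multiples_iff mult.commute)

lemma of_nat_mem_multiples: "(of_nat n :: 'a :: field_char_0) \<in> multiples n"
  using of_nat_mult_mem_multiples[of 1 n] by simp

text \<open>Such an ideal is the union of the cosets of nO inside it, so it is determined by a
  subset of a finite set.\<close>

lemma finite_ideals_containing:
  assumes "number_field TYPE('k :: field_char_0)" "n > 0"
  shows "finite {I :: 'k set. alg_ideal I \<and> of_nat n \<in> I}"
proof -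
  have mem: "I \<in> \<Union> ` Pow (cosets alg_ints (multiples n))" if I: "alg_ideal I" "of_nat n \<in> I" for I :: "'k set"
  proof
    show "cosets I (multiples n) \<in> Pow (cosets alg_ints (multiples n))"
      using alg_idealD(2)[OF I(1)] by (auto simp: cosets_def)
    have 1: "(\<lambda>h. h + x) ` multiples n \<subseteq> I" if "x \<in> I" for x
      using multiples_subset_ideal[OF I] alg_idealD(7)[OF I(1)] that by auto
    have 2: "x \<in> (\<lambda>h. h + x) ` multiples n" for x :: 'k
      unfolding mem_coset_iff using alg_idealD(5)[OF alg_ideal_multiples] by simp
    show "I = \<Union> (cosets I (multiples n))"
    proof (intro equalityI subsetI)
      show "x \<in> \<Union> (cosets I (multiples n))" if "x \<in> I" for x
        using 2[of x] coset_mem_cosets[OF that] by (rule UnionI[rotated])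
      show "x \<in> I" if "x \<in> \<Union> (cosets I (multiples n))" for x
        using that 1 unfolding cosets_def by blast
    qed
  qed
  have "finite (cosets (alg_ints :: 'k set) (multiples n))"
    using finite_cosets_multiples[OF assms] .
  then have fin: "finite (\<Union> ` Pow (cosets (alg_ints :: 'k set) (multiples n)))"
    by (intro finite_imageI) (simp only: finite_Pow_iff)
  show ?thesis
    by (rule finite_subset[OF _ fin], rule subsetI, elim CollectE conjE) (rule mem)
qed

lemma finite_cosets_ideal:
  assumes "number_field TYPE('k :: field_char_0)" "n > 0" "alg_ideal I" "of_nat n \<in> I"
  shows "finite (cosets (alg_ints :: 'k set) I)"
  using finite_cosets_mono[OF add_subgroup_multiples alg_idealD(3)[OF assms(3)]
      multiples_subset_ideal[OF assms(3,4)] finite_cosets_multiples[OF assms(1,2)]] .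

section \<open>Sums I + Ox and maximal ideals above p\<close>

definition ideal_adjoin :: "'a :: field_char_0 set \<Rightarrow> 'a \<Rightarrow> 'a set" where
  "ideal_adjoin I x = {h + a * x | h a. h \<in> I \<and> algebraic_int a}"

lemma ideal_adjoinI: "h \<in> I \<Longrightarrow> algebraic_int a \<Longrightarrow> h + a * x \<in> ideal_adjoin I x"
  unfolding ideal_adjoin_def by blast

lemma ideal_adjoinE:
  assumes "u \<in> ideal_adjoin I x"
  obtains h a where "h \<in> I" "algebraic_int a" "u = h + a * x"
  using assms unfolding ideal_adjoin_def by blast

lemma alg_ideal_adjoin:
  assumes I: "alg_ideal I" and x: "algebraic_int x"
  shows "alg_ideal (ideal_adjoin I x)" "I \<subseteq> ideal_adjoin I x" "x \<in> ideal_adjoin I x"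
proof -
  show sub: "I \<subseteq> ideal_adjoin I x" using ideal_adjoinI[of _ I 0 x] by auto
  show "x \<in> ideal_adjoin I x" using ideal_adjoinI[OF alg_idealD(5)[OF I], of 1 x] by simp
  show "alg_ideal (ideal_adjoin I x)"
    unfolding alg_ideal_def add_subgroup_def
  proof (intro conjI ballI allI impI)
    show "ideal_adjoin I x \<subseteq> alg_ints"
    proof (intro subsetI CollectI)
      fix u assume "u \<in> ideal_adjoin I x"
      then obtain h a where "h \<in> I" "algebraic_int a" "u = h + a * x" by (rule ideal_adjoinE)
      then show "algebraic_int u"
        using alg_idealD(1)[OF I] x by (simp add: algebraic_int_add algebraic_int_mult)
    qed
    show "0 \<in> ideal_adjoin I x" using sub alg_idealD(5)[OF I] by blast
    fix u v assume "u \<in> ideal_adjoin I x" "v \<in> ideal_adjoin I x"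
    then obtain h a h' a' where ha: "h \<in> I" "algebraic_int a" "h' \<in> I" "algebraic_int a'"
      and uv: "u = h + a * x" "v = h' + a' * x" by (metis ideal_adjoinE)
    have "u - v = (h - h') + (a - a') * x" by (simp add: uv algebra_simps)
    then show "u - v \<in> ideal_adjoin I x"
      using ideal_adjoinI[OF alg_idealD(6)[OF I ha(1,3)] algebraic_int_diff[OF ha(2,4)]] by simp
  next
    fix b u :: 'a assume b: "algebraic_int b" and "u \<in> ideal_adjoin I x"
    then obtain h a where ha: "h \<in> I" "algebraic_int a" "u = h + a * x" by (metis ideal_adjoinE)
    have "b * u = b * h + (b * a) * x" by (simp add: ha(3) algebra_simps)
    then show "b * u \<in> ideal_adjoin I x"
      using ideal_adjoinI[OF alg_idealD(4)[OF I b ha(1)] algebraic_int_mult[OF b ha(2)]] by simp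
  qed
qed

definition alg_maximal :: "'a :: field_char_0 set \<Rightarrow> bool" where
  "alg_maximal P \<longleftrightarrow> alg_ideal P \<and> 1 \<notin> P \<and> (\<forall>J. alg_ideal J \<longrightarrow> P \<subseteq> J \<longrightarrow> 1 \<notin> J \<longrightarrow> J = P)"

text \<open>Otherwise 1/p would be a rational algebraic integer, hence an integer.\<close>

lemma one_notin_multiples:
  assumes "p > 1"
  shows "(1 :: 'a :: field_char_0) \<notin> multiples p"
proof
  assume "(1 :: 'a) \<in> multiples p"
  then obtain x :: 'a where x: "algebraic_int x" "1 = of_nat p * x" unfolding multiples_iff by blast
  then have "x = 1 / of_nat p" using assms by (simp add: field_simps)
  then have "x \<in> \<rat>" by simp
  with x(1) have "x \<in> \<int>" by (rule rational_algebraic_int_is_int)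
  then obtain k where "x = of_int k" by (auto elim: Ints_cases)
  with x(2) have "of_int (int p * k) = (of_int 1 :: 'a)" by simp
  then have "int p * k = 1" by (simp only: of_int_eq_iff)
  then show False using assms by (simp add: zmult_eq_1_iff)
qed

text \<open>Only finitely many ideals contain \<open>p\<close>, so a maximal proper one exists
  without Zorn's lemma; any ideal above it contains \<open>p\<close> too and is covered by its
  maximality.\<close>

lemma exists_alg_maximal:
  assumes K: "number_field TYPE('k :: field_char_0)" and p: "prime p"
  shows "\<exists>P :: 'k set. alg_maximal P \<and> of_nat p \<in> P"
proof -
  let ?F = "{I :: 'k set. alg_ideal I \<and> of_nat p \<in> I \<and> 1 \<notin> I}"
  have "multiples p \<in> ?F"
    using alg_ideal_multiples of_nat_mem_multiples one_notin_multiples[OF prime_gt_1_nat[OF p]] by blast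
  moreover have "finite ?F"
    by (rule finite_subset[OF _ finite_ideals_containing[OF K prime_gt_0_nat[OF p]]]) blast
  ultimately obtain P where "P \<in> ?F" "\<And>J. J \<in> ?F \<Longrightarrow> P \<subseteq> J \<Longrightarrow> J = P"
    using finite_has_maximal[of ?F] by blast
  then show ?thesis unfolding alg_maximal_def by blast
qed

lemma alg_maximal_inverse:
  assumes "alg_maximal P" "algebraic_int a" "a \<notin> P"
  obtains h c where "h \<in> P" "algebraic_int c" "1 = h + c * a"
proof -
  have P: "alg_ideal P" using assms(1) by (simp add: alg_maximal_def)
  have "1 \<in> ideal_adjoin P a"
    using assms alg_ideal_adjoin[OF P assms(2)] unfolding alg_maximal_def by blast
  then show ?thesis by (rule ideal_adjoinE) (rule that)
qed

lemma alg_maximal_prime: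
  assumes "alg_maximal P" "algebraic_int a" "algebraic_int b" "a * b \<in> P"
  shows "a \<in> P \<or> b \<in> P"
proof (rule ccontr)
  assume neg: "\<not> (a \<in> P \<or> b \<in> P)"
  then obtain h c where h: "h \<in> P" "algebraic_int c" "1 = h + c * a"
    using alg_maximal_inverse[OF assms(1,2)] by blast
  have P: "alg_ideal P" using assms(1) by (simp add: alg_maximal_def)
  have "b = (h + c * a) * b" using h(3) by simp
  then have "b = b * h + c * (a * b)" by (simp add: algebra_simps)
  also have "\<dots> \<in> P"
    by (rule alg_idealD(7)[OF P alg_idealD(4)[OF P assms(3) h(1)] alg_idealD(4)[OF P h(2) assms(4)]])
  finally show False using neg by blast
qed

text \<open>The ideal PS + nO. When \<open>S\<close> generates \<open>I\<close> modulo nO and n lies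
  in \<open>I\<close>, it plays the role of PI + nO.\<close>

definition lin_comb_ideal :: "'a :: field_char_0 set \<Rightarrow> nat \<Rightarrow> 'a set \<Rightarrow> 'a set" where
  "lin_comb_ideal P n S = {(\<Sum>x\<in>S. a x * x) + y | a y. (\<forall>x\<in>S. a x \<in> P) \<and> y \<in> multiples n}"

lemma lin_comb_idealI:
  "\<forall>x\<in>S. a x \<in> P \<Longrightarrow> y \<in> multiples n \<Longrightarrow> (\<Sum>x\<in>S. a x * x) + y \<in> lin_comb_ideal P n S"
  unfolding lin_comb_ideal_def by blast

lemma alg_ideal_lin_comb_ideal:
  assumes P: "alg_ideal P" and S: "S \<subseteq> alg_ints"
  shows "alg_ideal (lin_comb_ideal P n S)"
  unfolding alg_ideal_def add_subgroup_def
proof (intro conjI ballI allI impI)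
  note N = alg_ideal_multiples[of n]
  show "lin_comb_ideal P n S \<subseteq> alg_ints"
  proof (intro subsetI CollectI)
    fix u assume "u \<in> lin_comb_ideal P n S"
    then obtain a y where u: "u = (\<Sum>x\<in>S. a x * x) + y" "\<forall>x\<in>S. a x \<in> P" "y \<in> multiples n"
      unfolding lin_comb_ideal_def by blast
    have "algebraic_int (a x * x)" if "x \<in> S" for x
      using u(2) that S alg_idealD(1)[OF P] by (intro algebraic_int_mult) auto
    then show "algebraic_int u"
      unfolding u(1) by (intro algebraic_int_add algebraic_int_sum alg_idealD(1)[OF N u(3)])
  qed
  show "0 \<in> lin_comb_ideal P n S"
    using lin_comb_idealI[of S "\<lambda>_. 0" P 0 n] alg_idealD(5)[OF P] alg_idealD(5)[OF N] by simp
  fix u v assume "u \<in> lin_comb_ideal P n S" "v \<in> lin_comb_ideal P n S"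
  then obtain a y b z where u: "u = (\<Sum>x\<in>S. a x * x) + y" "\<forall>x\<in>S. a x \<in> P" "y \<in> multiples n"
    and v: "v = (\<Sum>x\<in>S. b x * x) + z" "\<forall>x\<in>S. b x \<in> P" "z \<in> multiples n"
    unfolding lin_comb_ideal_def by blast
  have "u - v = (\<Sum>x\<in>S. (a x - b x) * x) + (y - z)"
    by (simp add: u v left_diff_distrib sum_subtractf)
  also have "\<dots> \<in> lin_comb_ideal P n S"
    using u v alg_idealD(6)[OF P] alg_idealD(6)[OF N] by (intro lin_comb_idealI) auto
  finally show "u - v \<in> lin_comb_ideal P n S" .
next
  fix c u :: 'a assume c: "algebraic_int c" and "u \<in> lin_comb_ideal P n S"
  then obtain a y where u: "u = (\<Sum>x\<in>S. a x * x) + y" "\<forall>x\<in>S. a x \<in> P" "y \<in> multiples n"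
    unfolding lin_comb_ideal_def by blast
  have "c * u = (\<Sum>x\<in>S. (c * a x) * x) + c * y"
    by (simp add: u distrib_left sum_distrib_left mult.assoc)
  also have "\<dots> \<in> lin_comb_ideal P n S"
    using u c alg_idealD(4)[OF P] alg_idealD(4)[OF alg_ideal_multiples] by (intro lin_comb_idealI) auto
  finally show "c * u \<in> lin_comb_ideal P n S" .
qed

text \<open>The relation for a generator \<open>z\<close> has coefficient \<open>s - b\<close> with \<open>b \<in> P\<close>, which stays outside \<open>P\<close>;
  so \<open>z\<close> can be eliminated at the cost of multiplying the remaining relations by it.\<close>

lemma nakayama_elimination:
  assumes P: "alg_maximal P" and "finite S" "S \<subseteq> alg_ints"
    and "algebraic_int s" "s \<notin> P" "\<And>x. x \<in> S \<Longrightarrow> s * x \<in> lin_comb_ideal P n S"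
  shows "\<exists>t. algebraic_int t \<and> t \<notin> P \<and> (\<forall>x\<in>S. t * x \<in> multiples n)"
  using assms(2-)
proof (induction S arbitrary: s)
  case (insert z S)
  have idP: "alg_ideal P" using P by (simp add: alg_maximal_def)
  have SO: "S \<subseteq> alg_ints" and z: "algebraic_int z" using insert.prems by auto
  let ?W = "lin_comb_ideal P n S"
  have W: "alg_ideal ?W" using idP SO by (rule alg_ideal_lin_comb_ideal)
  have split: "\<exists>b\<in>P. \<exists>w\<in>?W. s * x = b * z + w" if x: "x \<in> insert z S" for x
  proof -
    obtain a y where a: "s * x = (\<Sum>x\<in>insert z S. a x * x) + y" "\<forall>x\<in>insert z S. a x \<in> P" "y \<in> multiples n"
      using insert.prems(4)[OF x] unfolding lin_comb_ideal_def by blast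
    have "s * x = a z * z + ((\<Sum>x\<in>S. a x * x) + y)" using a(1) insert.hyps by (simp add: add.assoc)
    moreover have "(\<Sum>x\<in>S. a x * x) + y \<in> ?W" using a by (intro lin_comb_idealI) auto
    ultimately show ?thesis using a(2) by blast
  qed
  obtain b w where b: "b \<in> P" "w \<in> ?W" "s * z = b * z + w" using split[of z] by blast
  have algb: "algebraic_int b" using alg_idealD(1)[OF idP b(1)] .
  define u where "u = s - b"
  have u: "algebraic_int u" "u \<notin> P"
    using insert.prems(2,3) b alg_idealD(7)[OF idP, of u b]
    by (auto simp: u_def algebraic_int_diff[OF _ algb])
  have uz: "u * z = w" using b(3) by (simp add: u_def algebra_simps)
  have us: "algebraic_int (u * s)" "u * s \<notin> P"
    using u insert.prems(2,3) alg_maximal_prime[OF P u(1)] by (auto simp: algebraic_int_mult)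
  have "u * s * x \<in> ?W" if "x \<in> S" for x
  proof -
    obtain c v where c: "c \<in> P" "v \<in> ?W" "s * x = c * z + v" using split[of x] \<open>x \<in> S\<close> by blast
    have "u * s * x = u * (c * z + v)" by (simp add: mult.assoc c(3))
    also have "\<dots> = c * w + u * v" by (simp add: algebra_simps flip: uz)
    also have "\<dots> \<in> ?W"
      by (rule alg_idealD(7)[OF W alg_idealD(4)[OF W alg_idealD(1)[OF idP c(1)] b(2)]
            alg_idealD(4)[OF W u(1) c(2)]])
    finally show ?thesis .
  qed
  from insert.IH[OF SO us this] obtain t where
    t: "algebraic_int t" "t \<notin> P" "\<And>x. x \<in> S \<Longrightarrow> t * x \<in> multiples n" by blast
  have tu: "algebraic_int (t * u)" "t * u \<notin> P"
    using u t alg_maximal_prime[OF P t(1) u(1)] by (auto simp: algebraic_int_mult)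
  \<comment> \<open>For \<open>z\<close> itself, \<open>u * z = w\<close> combines elements of
    \<open>S\<close> up to a multiple of \<open>n\<close>, and \<open>t\<close> sends each of these
    into \<open>multiples n\<close>. On \<open>S\<close> the factor \<open>t\<close> already does
    so.\<close>
  have "t * u * x \<in> multiples n" if x: "x \<in> insert z S" for x
  proof (cases "x = z")
    case True
    obtain a y where a: "w = (\<Sum>x\<in>S. a x * x) + y" "\<forall>x\<in>S. a x \<in> P" "y \<in> multiples n"
      using b(2) unfolding lin_comb_ideal_def by blast
    have sum: "(\<Sum>x\<in>T. a x * (t * x)) \<in> multiples n" if "T \<subseteq> S" for T
      using finite_subset[OF that insert.hyps(1)] that
    proof (induction T rule: finite_induct)
      case (insert r T)
      then have "algebraic_int (a r)" "t * r \<in> multiples n"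
        using a(2) t(3) alg_idealD(1)[OF idP] by auto
      then have "a r * (t * r) \<in> multiples n" by (rule mult_mem_multiples)
      then show ?case using insert alg_idealD(7)[OF alg_ideal_multiples] by simp
    qed (simp add: alg_idealD(5)[OF alg_ideal_multiples])
    have "t * u * x = (\<Sum>x\<in>S. a x * (t * x)) + t * y"
      using True uz by (simp add: mult.assoc a(1) distrib_left sum_distrib_left mult.left_commute)
    then show ?thesis
      using sum[OF subset_refl] mult_mem_multiples[OF t(1) a(3)] alg_idealD(7)[OF alg_ideal_multiples] by simp
  next
    case False
    then have "t * x \<in> multiples n" using that t(3) by blast
    with u(1) have "u * (t * x) \<in> multiples n" by (rule mult_mem_multiples)
    then show ?thesis by (simp add: algebra_simps)
  qed
  with tu show ?case by blast
qed blast

text \<open>For \<open>x\<close> in \<open>I\<close> but not in \<open>J\<close>, maximality of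
  \<open>J\<close> gives I = J + Ox. The annihilator of \<open>x\<close> modulo \<open>J\<close> is
  a proper ideal containing \<open>P\<close>, hence equals \<open>P\<close>, so a -> ax induces a
  bijection from O/P to I/J.\<close>

lemma exists_simple_quotient:
  fixes I P :: "'k :: field_char_0 set"
  assumes K: "number_field TYPE('k)" and p: "p > 0"
    and P: "alg_maximal P" "of_nat p \<in> P" and I: "alg_ideal I" "of_nat (p ^ m) \<in> I"
  shows "\<exists>J. alg_ideal J \<and> J \<subseteq> I \<and> of_nat (p ^ Suc m) \<in> J \<and> finite (cosets I J) \<and>
           card (cosets I J) = card (cosets alg_ints P)"
proof -
  define n where "n = p ^ Suc m"
  have n: "n > 0" using p by (simp add: n_def)
  have idP: "alg_ideal P" "1 \<notin> P" using P(1) by (simp_all add: alg_maximal_def)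
  have nI: "of_nat n \<in> I"
    using alg_idealD(4)[OF I(1) algebraic_int_of_nat I(2), of p] by (simp add: n_def)
  note N = alg_ideal_multiples[of n, where ?'a = 'k]
  \<comment> \<open>One representative for each coset of nO in \<open>I\<close>: a finite set that
    generates \<open>I\<close> modulo nO, which replaces finite generation of
    \<open>I\<close>.\<close>
  define S where "S = (\<lambda>C. SOME x. x \<in> C) ` cosets I (multiples n)"
  have "cosets I (multiples n) \<subseteq> cosets alg_ints (multiples n)"
    using alg_idealD(2)[OF I(1)] unfolding cosets_def by (rule image_mono)
  then have finS: "finite S"
    unfolding S_def using finite_cosets_multiples[OF K n] by (intro finite_imageI) (rule finite_subset)
  have rep: "(SOME y. y \<in> (\<lambda>h. h + x) ` multiples n) - x \<in> multiples n" for x :: 'k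
  proof -
    have "x \<in> (\<lambda>h. h + x) ` multiples n" unfolding mem_coset_iff using alg_idealD(5)[OF N] by simp
    then have "(SOME y. y \<in> (\<lambda>h. h + x) ` multiples n) \<in> (\<lambda>h. h + x) ` multiples n" by (rule someI)
    then show ?thesis unfolding mem_coset_iff .
  qed
  have SI: "S \<subseteq> I"
  proof
    fix s assume "s \<in> S"
    then obtain x where x: "x \<in> I" "s = (SOME y. y \<in> (\<lambda>h. h + x) ` multiples n)"
      unfolding S_def cosets_def by blast
    then have "s - x \<in> I" using rep multiples_subset_ideal[OF I(1) nI] by blast
    from alg_idealD(7)[OF I(1) this x(1)] show "s \<in> I" by simp
  qed
  have Srep: "\<exists>s\<in>S. x - s \<in> multiples n" if "x \<in> I" for x
  proof
    show "(SOME y. y \<in> (\<lambda>h. h + x) ` multiples n) \<in> S"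
      unfolding S_def by (rule imageI) (rule coset_mem_cosets[OF that])
    show "x - (SOME y. y \<in> (\<lambda>h. h + x) ` multiples n) \<in> multiples n"
      using add_subgroupD(3)[OF add_subgroup_multiples rep] by simp
  qed
  have SO: "S \<subseteq> alg_ints" using SI alg_idealD(2)[OF I(1)] by blast
  define W where "W = lin_comb_ideal P n S"
  have W: "alg_ideal W" unfolding W_def using idP(1) SO by (rule alg_ideal_lin_comb_ideal)
  have NW: "multiples n \<subseteq> W"
  proof
    fix y :: 'k assume "y \<in> multiples n"
    then show "y \<in> W"
      using lin_comb_idealI[of S "\<lambda>_. 0" P y n] alg_idealD(5)[OF idP(1)] by (simp add: W_def)
  qed
  have PSW: "a * s \<in> W" if "a \<in> P" "s \<in> S" for a s
  proof -
    have "(\<Sum>t\<in>S. (if t = s then a else 0) * t) + 0 \<in> W"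
      unfolding W_def using that alg_idealD(5)[OF idP(1)] alg_idealD(5)[OF N]
      by (intro lin_comb_idealI) auto
    also have "(\<Sum>t\<in>S. (if t = s then a else 0) * t) = (\<Sum>t\<in>S. if t = s then a * t else 0)"
      by (intro sum.cong) auto
    also have "\<dots> = a * s" using finS that(2) by simp
    finally show ?thesis by simp
  qed
  have PIW: "a * x \<in> W" if a: "a \<in> P" and x: "x \<in> I" for a x
  proof -
    obtain s where s: "s \<in> S" "x - s \<in> multiples n" using Srep[OF x] by blast
    have "a * (x - s) \<in> W"
      using mult_mem_multiples[OF alg_idealD(1)[OF idP(1) a] s(2)] NW by blast
    from alg_idealD(7)[OF W this PSW[OF a s(1)]] show ?thesis by (simp add: algebra_simps)
  qed
  have WI: "W \<subseteq> I"
  proof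
    fix u assume "u \<in> W"
    then obtain a y where u: "u = (\<Sum>x\<in>S. a x * x) + y" "\<forall>x\<in>S. a x \<in> P" "y \<in> multiples n"
      unfolding W_def lin_comb_ideal_def by blast
    have "(\<Sum>x\<in>T. a x * x) \<in> I" if "T \<subseteq> S" for T
      using finite_subset[OF that finS] that
    proof (induction T rule: finite_induct)
      case (insert x T)
      then have "a x \<in> P" "x \<in> I" using u(2) SI by auto
      then have "a x * x \<in> I" using alg_idealD(1)[OF idP(1)] alg_idealD(4)[OF I(1)] by blast
      then show ?case using insert alg_idealD(7)[OF I(1)] by simp
    qed (simp add: alg_idealD(5)[OF I(1)])
    moreover have "y \<in> I" using u(3) multiples_subset_ideal[OF I(1) nI] by blast
    ultimately show "u \<in> I" unfolding u(1) using alg_idealD(7)[OF I(1)] by blast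
  qed
  have "W \<noteq> I"
  proof
    assume "W = I"
    \<comment> \<open>If \<open>W\<close> were all of \<open>I\<close>, it would contain
      \<open>S\<close>, so the elimination can start with the multiplier 1, which is outside
      \<open>P\<close>.\<close>
    then have "\<exists>t. algebraic_int t \<and> t \<notin> P \<and> (\<forall>x\<in>S. t * x \<in> multiples n)"
      using SI idP(2) by (intro nakayama_elimination[OF P(1) finS SO, of 1]) (auto simp: W_def)
    then obtain t where t: "algebraic_int t" "t \<notin> P" "\<And>x. x \<in> S \<Longrightarrow> t * x \<in> multiples n" by blast
    obtain s where s: "s \<in> S" "of_nat (p ^ m) - s \<in> multiples n" using Srep[OF I(2)] by blast
    have "t * (of_nat (p ^ m) - s) + t * s \<in> multiples n"
      using mult_mem_multiples[OF t(1) s(2)] t(3)[OF s(1)] by (rule alg_idealD(7)[OF N])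
    then have "t * of_nat (p ^ m) \<in> multiples n" by (simp add: algebra_simps)
    then obtain x where x: "algebraic_int x" "t * of_nat (p ^ m) = of_nat n * x"
      unfolding multiples_iff by blast
    then have "of_nat (p ^ m) * t = of_nat (p ^ m) * (x * of_nat p)"
      by (simp add: n_def algebra_simps)
    moreover have "(of_nat (p ^ m) :: 'k) \<noteq> 0" using p by simp
    ultimately have "t = x * of_nat p" using mult_left_cancel by blast
    then have "t \<in> P" using alg_idealD(4)[OF idP(1) x(1) P(2)] by simp
    with t(2) show False by blast
  qed
  define F where "F = {J. alg_ideal J \<and> W \<subseteq> J \<and> J \<subset> I}"
  have nW: "of_nat n \<in> W" using NW of_nat_mem_multiples by blast
  have "finite F"
    by (rule finite_subset[OF _ finite_ideals_containing[OF K n]]) (use nW in \<open>unfold F_def, blast\<close>)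
  moreover have "W \<in> F" using W WI \<open>W \<noteq> I\<close> unfolding F_def by blast
  ultimately obtain J where JF: "J \<in> F" and max: "\<And>J'. J' \<in> F \<Longrightarrow> J \<subseteq> J' \<Longrightarrow> J' = J"
    using finite_has_maximal[of F] by blast
  have J: "alg_ideal J" "W \<subseteq> J" "J \<subset> I" using JF by (simp_all add: F_def)
  then obtain x where x: "x \<in> I" "x \<notin> J" by blast
  have algx: "algebraic_int x" using alg_idealD(1)[OF I(1) x(1)] .
  note adj = alg_ideal_adjoin[OF J(1) algx]
  have mulI: "a * x \<in> I" if "algebraic_int a" for a using alg_idealD(4)[OF I(1) that x(1)] .
  have "ideal_adjoin J x \<subseteq> I"
  proof
    fix u assume "u \<in> ideal_adjoin J x"
    then obtain h a where "h \<in> J" "algebraic_int a" "u = h + a * x" by (rule ideal_adjoinE)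
    then show "u \<in> I" using J(3) mulI alg_idealD(7)[OF I(1)] by blast
  qed
  moreover have "ideal_adjoin J x \<notin> F" using max[of "ideal_adjoin J x"] adj x(2) by blast
  ultimately have adjI: "ideal_adjoin J x = I" using adj J(2) unfolding F_def by blast
  \<comment> \<open>The annihilator of \<open>x\<close> in I/J.\<close>
  define Q where "Q = {a. algebraic_int a \<and> a * x \<in> J}"
  have "alg_ideal Q"
    unfolding alg_ideal_def add_subgroup_def Q_def
    using alg_idealD[OF J(1)]
    by (simp add: subset_iff algebraic_int_diff algebraic_int_mult left_diff_distrib mult.assoc)
  moreover have "P \<subseteq> Q"
    using PIW x(1) J(2) alg_idealD(1)[OF idP(1)] unfolding Q_def by blast
  moreover have "1 \<notin> Q" using x(2) by (simp add: Q_def)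
  ultimately have QP: "Q = P" using P(1) unfolding alg_maximal_def by blast
  have ker: "a * x - b * x \<in> J \<longleftrightarrow> a - b \<in> P" if "algebraic_int a" "algebraic_int b" for a b
    unfolding QP[symmetric] Q_def using that by (simp add: algebraic_int_diff left_diff_distrib)
  have cosIJ: "cosets I J = (\<lambda>a. (\<lambda>h. h + a * x) ` J) ` alg_ints"
  proof (intro equalityI subsetI)
    fix C assume "C \<in> cosets I J"
    then obtain u where u: "u \<in> I" "C = (\<lambda>h. h + u) ` J" unfolding cosets_def by blast
    then obtain h a where "h \<in> J" "algebraic_int a" "u = h + a * x"
      unfolding adjI[symmetric] by (auto elim: ideal_adjoinE)
    then have "(\<lambda>h. h + u) ` J = (\<lambda>h. h + a * x) ` J" "a \<in> alg_ints"
      by (simp_all add: coset_eq_iff[OF alg_idealD(3)[OF J(1)]])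
    then show "C \<in> (\<lambda>a. (\<lambda>h. h + a * x) ` J) ` alg_ints" using u(2) by blast
  next
    fix C assume "C \<in> (\<lambda>a. (\<lambda>h. h + a * x) ` J) ` alg_ints"
    then show "C \<in> cosets I J" using mulI by (auto intro: coset_mem_cosets)
  qed
  obtain \<phi> where "bij_betw \<phi> (cosets alg_ints P) (cosets I J)"
    unfolding cosIJ unfolding cosets_def
    using bij_betw_image_of_kernel[of alg_ints "\<lambda>a. (\<lambda>h. h + a) ` P" "\<lambda>a. (\<lambda>h. h + a * x) ` J"]
    by (auto simp: coset_eq_iff[OF alg_idealD(3)[OF J(1)]] coset_eq_iff[OF alg_idealD(3)[OF idP(1)]] ker)
  then have "finite (cosets I J)" "card (cosets I J) = card (cosets alg_ints P)"
    using finite_cosets_ideal[OF K p idP(1) P(2)]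
    by (simp_all add: bij_betw_finite bij_betw_same_card[symmetric])
  moreover have "of_nat (p ^ Suc m) \<in> J" using nW J(2) unfolding n_def by blast
  ultimately show ?thesis using J by blast
qed

text \<open>The membership of \<open>p ^ m\<close> is carried along because
  \<open>exists_simple_quotient\<close> needs it for the next step; indices multiply by
  \<open>card_cosets_tower\<close>.\<close>

lemma exists_ideal_index_power:
  fixes P :: "'k :: field_char_0 set"
  assumes K: "number_field TYPE('k)" and p: "p > 0"
    and P: "alg_maximal P" "of_nat p \<in> P"
  shows "\<exists>I :: 'k set. alg_ideal I \<and> of_nat (p ^ m) \<in> I \<and> finite (cosets alg_ints I) \<and>
           card (cosets alg_ints I) = card (cosets alg_ints P) ^ m"
proof (induction m)
  case 0
  show ?case
    using alg_ideal_alg_ints cosets_self[OF add_subgroup_alg_ints[where 'a = 'k]]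
    by (intro exI[of _ alg_ints]) simp
next
  case (Suc m)
  then obtain I :: "'k set" where I: "alg_ideal I" "of_nat (p ^ m) \<in> I" "finite (cosets alg_ints I)"
    "card (cosets alg_ints I) = card (cosets alg_ints P) ^ m" by blast
  obtain J where J: "alg_ideal J" "J \<subseteq> I" "of_nat (p ^ Suc m) \<in> J" "finite (cosets I J)"
    "card (cosets I J) = card (cosets alg_ints P)"
    using exists_simple_quotient[OF K p P I(1,2)] by blast
  have "finite (cosets alg_ints J)" "card (cosets alg_ints J) = card (cosets alg_ints P) ^ Suc m"
    using card_cosets_tower[OF alg_idealD(3)[OF J(1)] alg_idealD(3)[OF I(1)] add_subgroup_alg_ints
        J(2) alg_idealD(2)[OF I(1)] I(3) J(4)] I(4) J(5) by (simp_all add: mult.commute)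
  with J show ?case by blast
qed

section \<open>Frobenius elements\<close>

text \<open>The inner binomial coefficients are divisible by \<open>p\<close>. The cofactor is kept
  explicit so that it can be seen to be an algebraic integer.\<close>

lemma prime_power_sum:
  fixes x y :: "'a :: comm_ring_1"
  assumes p: "prime p"
  shows "(x + y) ^ p = x ^ p + y ^ p +
    of_nat p * (\<Sum>k\<in>{1..<p}. of_nat ((p choose k) div p) * x ^ k * y ^ (p - k))"
proof -
  have "p > 0" using prime_gt_0_nat[OF p] .
  then have "{..p} = insert 0 (insert p {1..<p})" by auto
  then have "(x + y) ^ p = x ^ p + y ^ p + (\<Sum>k\<in>{1..<p}. of_nat (p choose k) * x ^ k * y ^ (p - k))"
    using \<open>p > 0\<close> by (simp add: binomial_ring add.assoc add.commute)
  also have "(\<Sum>k\<in>{1..<p}. of_nat (p choose k) * x ^ k * y ^ (p - k))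
      = (\<Sum>k\<in>{1..<p}. of_nat p * (of_nat ((p choose k) div p) * x ^ k * y ^ (p - k)))"
  proof (intro sum.cong refl)
    fix k assume "k \<in> {1..<p}"
    then have "p dvd p choose k" using p by (intro dvd_choose_prime) auto
    then have "(of_nat (p choose k) :: 'a) = of_nat p * of_nat ((p choose k) div p)"
      by (metis dvd_mult_div_cancel of_nat_mult)
    then show "of_nat (p choose k) * x ^ k * y ^ (p - k)
        = of_nat p * (of_nat ((p choose k) div p) * x ^ k * y ^ (p - k))"
      by (simp add: mult.assoc)
  qed
  finally show ?thesis by (simp add: sum_distrib_left)
qed

lemma prime_power_sum_multiples:
  fixes x y :: "'a :: field_char_0"
  assumes "prime p" "algebraic_int x" "algebraic_int y"
  shows "(x + y) ^ p - (x ^ p + y ^ p) \<in> multiples p"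
proof -
  have "(x + y) ^ p - (x ^ p + y ^ p) =
      of_nat p * (\<Sum>k\<in>{1..<p}. of_nat ((p choose k) div p) * x ^ k * y ^ (p - k))"
    unfolding prime_power_sum[OF assms(1)] by (rule add_diff_cancel_left')
  also have "\<dots> \<in> multiples p"
    using assms(2,3) by (intro of_nat_mult_mem_multiples algebraic_int_sum algebraic_int_mult
        algebraic_int_power algebraic_int_of_nat)
  finally show ?thesis .
qed

lemma fermat_int:
  fixes a :: int
  assumes p: "prime p"
  shows "int p dvd a ^ p - a"
proof -
  have step: "int p dvd (b + 1) ^ p - (b ^ p + 1)" for b :: int
    unfolding prime_power_sum[OF p] by simp
  show ?thesis
  proof (induction a rule: int_induct[where k = 0])
    case base
    show ?case using prime_gt_0_nat[OF p] by (simp add: zero_power)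
  next
    case (step1 a)
    from dvd_add[OF step[of a] step1(2)] show ?case by (simp add: algebra_simps)
  next
    case (step2 a)
    from dvd_diff[OF step2(2) step[of "a - 1"]] show ?case by (simp add: algebra_simps)
  qed
qed

text \<open>Modulo \<open>p\<close>, taking p-th powers is additive and fixes integer coefficients
  by Fermat, so it can be moved inside the polynomial.\<close>

lemma poly_frobenius_multiples:
  fixes x :: "'a :: field_char_0" and f :: "int poly"
  assumes p: "prime p" and x: "algebraic_int x"
  shows "poly (map_poly of_int f) (x ^ p) - poly (map_poly of_int f) x ^ p \<in> multiples p"
proof (induction f)
  case 0
  show ?case using prime_gt_0_nat[OF p] alg_idealD(5)[OF alg_ideal_multiples] by (simp add: zero_power)
next
  case (pCons a f)
  let ?f = "poly (map_poly of_int f) :: 'a \<Rightarrow> 'a"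
  note N = alg_ideal_multiples[of p, where ?'a = 'a]
  have alg: "algebraic_int (?f x)"
    using x by (simp add: poly_altdef algebraic_int_sum algebraic_int_mult algebraic_int_power coeff_map_poly)
  obtain k where "a ^ p - a = int p * k" using fermat_int[OF p] by blast
  then have "(of_int (a ^ p - a) :: 'a) = of_nat p * of_int k" by simp
  then have 1: "(of_int a :: 'a) ^ p - of_int a \<in> multiples p"
    using of_nat_mult_mem_multiples[OF algebraic_int_of_int, of p k] by simp
  have 2: "(of_int a + x * ?f x) ^ p - (of_int a ^ p + (x * ?f x) ^ p) \<in> multiples p"
    using p x alg by (intro prime_power_sum_multiples algebraic_int_mult algebraic_int_of_int)
  have 3: "x ^ p * (?f (x ^ p) - ?f x ^ p) \<in> multiples p"
    using algebraic_int_power[OF x] pCons.IH by (rule mult_mem_multiples)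
  \<comment> \<open>The errors of the induction hypothesis, of additivity and of Fermat combine
    exactly to the difference for the Horner form of \<open>pCons a f\<close>.\<close>
  have "x ^ p * (?f (x ^ p) - ?f x ^ p) - ((of_int a + x * ?f x) ^ p - (of_int a ^ p + (x * ?f x) ^ p))
      - (of_int a ^ p - of_int a) \<in> multiples p"
    by (rule alg_idealD(6)[OF N alg_idealD(6)[OF N 3 2] 1])
  also have "x ^ p * (?f (x ^ p) - ?f x ^ p) - ((of_int a + x * ?f x) ^ p - (of_int a ^ p + (x * ?f x) ^ p))
      - (of_int a ^ p - of_int a) = (of_int a + x ^ p * ?f (x ^ p)) - (of_int a + x * ?f x) ^ p"
    by (simp add: power_mult_distrib right_diff_distrib)
  finally show ?case by (simp add: of_int_hom.map_poly_pCons_hom)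
qed

lemma algebraic_int_coeff_prod:
  fixes F :: "'b \<Rightarrow> 'a :: field_char_0 poly"
  assumes "\<And>s i. s \<in> A \<Longrightarrow> algebraic_int (poly.coeff (F s) i)"
  shows "algebraic_int (poly.coeff (prod F A) i)"
  using assms
proof (induction A arbitrary: i rule: infinite_finite_induct)
  case (insert s A)
  then show ?case
    by (simp add: coeff_mult algebraic_int_sum algebraic_int_mult)
qed (simp_all add: coeff_1)

lemma alg_maximal_prod:
  fixes f :: "'b \<Rightarrow> 'a :: field_char_0"
  assumes P: "alg_maximal P" and "finite A" "\<And>s. s \<in> A \<Longrightarrow> algebraic_int (f s)" "prod f A \<in> P"
  shows "\<exists>s\<in>A. f s \<in> P"
  using assms(2-)
proof (induction A rule: finite_induct)
  case empty
  then show ?case using P by (simp add: alg_maximal_def)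
next
  case (insert s A)
  have "algebraic_int (prod f A)"
    using insert.prems(1) by (simp add: algebraic_int_prod)
  then have "f s \<in> P \<or> prod f A \<in> P"
    using insert by (intro alg_maximal_prime[OF P]) auto
  then show ?case using insert.IH insert.prems(1) by blast
qed

lemma ideal_power_diff:
  assumes P: "alg_ideal P" and x: "algebraic_int x" and y: "algebraic_int y" and "x - y \<in> P"
  shows "x ^ n - y ^ n \<in> P"
proof (induction n)
  case (Suc n)
  have "x * (x ^ n - y ^ n) + y ^ n * (x - y) \<in> P"
    by (rule alg_idealD(7)[OF P alg_idealD(4)[OF P x Suc] alg_idealD(4)[OF P algebraic_int_power[OF y] assms(4)]])
  then show ?case by (simp add: algebra_simps)
qed (simp add: alg_idealD(5)[OF P])

text \<open>The facts through which the Galois group acts on integers and ideals; its exponent is a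
  separate assumption of the lemmas that use it.\<close>

locale galois_action =
  fixes G :: "('k :: field_char_0 \<Rightarrow> 'k) set"
  assumes finite_G: "finite G" and id_G: "id \<in> G"
    and comp_G: "\<And>\<sigma> \<tau>. \<sigma> \<in> G \<Longrightarrow> \<tau> \<in> G \<Longrightarrow> \<sigma> \<circ> \<tau> \<in> G"
    and add: "\<And>\<sigma> x y. \<sigma> \<in> G \<Longrightarrow> \<sigma> (x + y) = \<sigma> x + \<sigma> y"
    and mult: "\<And>\<sigma> x y. \<sigma> \<in> G \<Longrightarrow> \<sigma> (x * y) = \<sigma> x * \<sigma> y"
    and one: "\<And>\<sigma>. \<sigma> \<in> G \<Longrightarrow> \<sigma> 1 = 1"
    and fixed: "\<And>x. (\<forall>\<sigma>\<in>G. \<sigma> x = x) \<Longrightarrow> x \<in> \<rat>"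
begin

lemma comm_ring_hom: "\<sigma> \<in> G \<Longrightarrow> comm_ring_hom \<sigma>"
proof
  assume \<sigma>: "\<sigma> \<in> G"
  show "\<sigma> 0 = 0" using add[OF \<sigma>, of 0 0] by simp
qed (simp_all add: add mult one)

lemma inj_hom: assumes "\<sigma> \<in> G" shows "inj \<sigma>"
proof (rule injI)
  interpret comm_ring_hom \<sigma> using assms by (rule comm_ring_hom)
  fix x y assume "\<sigma> x = \<sigma> y"
  then have "\<sigma> (x - y) = 0" by (simp add: hom_minus)
  have "x - y = 0"
  proof (rule ccontr)
    assume "x - y \<noteq> 0"
    then have "\<sigma> (x - y) * \<sigma> (inverse (x - y)) = 1" by (simp flip: hom_mult)
    with \<open>\<sigma> (x - y) = 0\<close> show False by simp
  qed
  then show "x = y" by simp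
qed

lemma hom_poly:
  assumes "\<sigma> \<in> G"
  shows "\<sigma> (poly (map_poly of_int f) x) = poly (map_poly of_int f) (\<sigma> x)"
proof -
  interpret comm_ring_hom \<sigma> using assms by (rule comm_ring_hom)
  show ?thesis by (induction f) (simp_all add: of_int_hom.map_poly_pCons_hom hom_distribs)
qed

lemma algebraic_int_hom:
  assumes "\<sigma> \<in> G" "algebraic_int x"
  shows "algebraic_int (\<sigma> x)"
proof -
  interpret comm_ring_hom \<sigma> using assms(1) by (rule comm_ring_hom)
  obtain f where "poly (map_poly of_int f) x = 0" "lead_coeff f = 1"
    using assms(2) unfolding algebraic_int_altdef_ipoly by blast
  then have "poly (map_poly of_int f) (\<sigma> x) = 0" "lead_coeff f = 1"
    using hom_poly[OF assms(1), of f x] by simp_all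
  then show ?thesis unfolding algebraic_int_altdef_ipoly by blast
qed

lemma hom_diff: "\<sigma> \<in> G \<Longrightarrow> \<sigma> (x - y) = \<sigma> x - \<sigma> y"
  using comm_ring_hom by (metis add diff_add_cancel add_diff_cancel)

text \<open>Composition with \<open>\<tau>\<close> is injective because \<open>\<tau>\<close> is,
  and an injective self-map of the finite set \<open>G\<close> is onto.\<close>

lemma bij_comp:
  assumes "\<tau> \<in> G"
  shows "bij_betw (\<lambda>\<sigma>. \<tau> \<circ> \<sigma>) G G"
proof -
  have "inj_on (\<lambda>\<sigma>. \<tau> \<circ> \<sigma>) G"
    using inj_hom[OF assms] by (intro inj_onI) (simp add: fun.inj_map_strong inj_def fun_eq_iff)
  then show ?thesis
    using finite_G comp_G[OF assms] by (simp add: bij_betw_def endo_inj_surj image_subset_iff)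
qed

text \<open>For the Galois group of a number field Galois over the rationals, this is the
  characteristic polynomial of multiplication by \<open>x\<close>.\<close>

definition char_poly_of :: "'k \<Rightarrow> 'k poly" where
  "char_poly_of x = (\<Prod>\<sigma>\<in>G. [:- \<sigma> x, 1:])"

lemma map_poly_char_poly_of:
  assumes \<tau>: "\<tau> \<in> G"
  shows "map_poly \<tau> (char_poly_of x) = char_poly_of x"
proof -
  interpret comm_ring_hom \<tau> using \<tau> by (rule comm_ring_hom)
  interpret mp: map_poly_comm_ring_hom \<tau> ..
  have "map_poly \<tau> (char_poly_of x) = (\<Prod>\<sigma>\<in>G. [:- (\<tau> \<circ> \<sigma>) x, 1:])"
    unfolding char_poly_of_def mp.hom_prod by (simp add: map_poly_pCons_hom hom_distribs)
  also have "\<dots> = char_poly_of x"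
    unfolding char_poly_of_def by (rule prod.reindex_bij_betw[OF bij_comp[OF \<tau>], of "\<lambda>\<sigma>. [:- \<sigma> x, 1:]"])
  finally show ?thesis .
qed

text \<open>The coefficients are polynomial expressions in the conjugates, hence algebraic integers.
  They are fixed by \<open>G\<close>, which permutes the factors, hence rational, and so they are
  integers.\<close>

lemma char_poly_of_int:
  assumes x: "algebraic_int x"
  obtains f where "char_poly_of x = map_poly of_int f"
proof -
  have "poly.coeff (char_poly_of x) i \<in> \<int>" for i
  proof (rule rational_algebraic_int_is_int)
    show "algebraic_int (poly.coeff (char_poly_of x) i)"
      unfolding char_poly_of_def
      by (rule algebraic_int_coeff_prod) (simp add: coeff_pCons algebraic_int_hom[OF _ x] split: nat.splits)
    show "poly.coeff (char_poly_of x) i \<in> \<rat>"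
    proof (intro fixed ballI)
      fix \<tau> assume \<tau>: "\<tau> \<in> G"
      interpret comm_ring_hom \<tau> using \<tau> by (rule comm_ring_hom)
      show "\<tau> (poly.coeff (char_poly_of x) i) = poly.coeff (char_poly_of x) i"
        using arg_cong[OF map_poly_char_poly_of[OF \<tau>, of x], of "\<lambda>q. poly.coeff q i"]
        by (simp add: coeff_map_poly)
    qed
  qed
  then have "\<forall>i. \<exists>k. poly.coeff (char_poly_of x) i = of_int k" by (auto elim: Ints_cases)
  then obtain c where c: "\<And>i. poly.coeff (char_poly_of x) i = of_int (c i)" by metis
  \<comment> \<open>Only an eventually vanishing sequence is recovered as the coefficients of its
    \<open>Abs_poly\<close>.\<close>
  have "c i = 0" if "i > degree (char_poly_of x)" for i
    using c[of i] coeff_eq_0[OF that] by simp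
  then have "poly.coeff (Abs_poly c) = c"
    by (intro Abs_poly_inverse CollectI) (auto simp: MOST_nat)
  then have "char_poly_of x = map_poly of_int (Abs_poly c)"
    by (intro poly_eqI) (simp add: coeff_map_poly c)
  then show ?thesis by (rule that)
qed

text \<open>The polynomial with roots \<open>\<sigma> x\<close> is integral and vanishes at \<open>x\<close>, hence modulo \<open>p\<close> also at \<open>x\<^sup>p\<close>.\<close>

lemma exists_local_frobenius:
  assumes p: "prime p" and P: "alg_maximal P" "of_nat p \<in> P" and x: "algebraic_int x"
  shows "\<exists>\<sigma>\<in>G. x ^ p - \<sigma> x \<in> P"
proof -
  have idP: "alg_ideal P" using P(1) by (simp add: alg_maximal_def)
  obtain f where f: "char_poly_of x = map_poly of_int f" using char_poly_of_int[OF x] .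
  have "poly (char_poly_of x) x = 0"
    unfolding char_poly_of_def poly_prod
    using finite_G id_G by (intro prod_zero) (auto intro!: bexI[of _ id])
  then have "poly (char_poly_of x) (x ^ p) \<in> multiples p"
    using poly_frobenius_multiples[OF p x, of f] prime_gt_0_nat[OF p] by (simp add: f zero_power)
  then have "poly (char_poly_of x) (x ^ p) \<in> P"
    using multiples_subset_ideal[OF idP P(2)] by blast
  then have "(\<Prod>\<sigma>\<in>G. x ^ p - \<sigma> x) \<in> P"
    by (simp add: char_poly_of_def poly_prod)
  moreover have "algebraic_int (x ^ p - \<sigma> x)" if "\<sigma> \<in> G" for \<sigma>
    using algebraic_int_diff[OF algebraic_int_power[OF x] algebraic_int_hom[OF that x]] .
  ultimately show ?thesis by (intro alg_maximal_prod[OF P(1) finite_G])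
qed

text \<open>Some \<open>a\<close> outside \<open>P\<close> has \<open>\<sigma> a\<close> in
  \<open>P\<close>. Otherwise membership in \<open>P\<close> would pass from
  \<open>\<sigma> a\<close> to \<open>a\<close>, and descending \<open>l - 1\<close> times from
  \<open>x = (\<sigma> ^^ l) x\<close> would put \<open>\<sigma> x\<close> in \<open>P\<close>.
  Making \<open>a\<close> congruent to 1 modulo \<open>P\<close> by an inverse gives
  \<open>e\<close>.\<close>

lemma hom_ideal_separation:
  assumes \<sigma>: "\<sigma> \<in> G" "\<sigma> ^^ l = id" "l > 0"
    and P: "alg_maximal P" and x: "x \<in> P" "\<sigma> x \<notin> P"
  shows "\<exists>e. algebraic_int e \<and> 1 - e \<in> P \<and> \<sigma> e \<in> P"
proof -
  have idP: "alg_ideal P" using P by (simp add: alg_maximal_def)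
  have "\<exists>a. algebraic_int a \<and> \<sigma> a \<in> P \<and> a \<notin> P"
  proof (rule ccontr)
    assume neg: "\<not> (\<exists>a. algebraic_int a \<and> \<sigma> a \<in> P \<and> a \<notin> P)"
    have descend: "algebraic_int a \<Longrightarrow> (\<sigma> ^^ k) a \<in> P \<Longrightarrow> a \<in> P" for a k
    proof (induction k arbitrary: a)
      case (Suc k)
      have "(\<sigma> ^^ k) (\<sigma> a) \<in> P" using Suc.prems(2) by (simp only: funpow_Suc_right o_apply)
      then have "\<sigma> a \<in> P" by (rule Suc.IH[OF algebraic_int_hom[OF \<sigma>(1) Suc.prems(1)]])
      then show ?case using neg Suc.prems(1) by blast
    qed simp
    have "algebraic_int (\<sigma> x)" using algebraic_int_hom[OF \<sigma>(1) alg_idealD(1)[OF idP x(1)]] .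
    moreover have "(\<sigma> ^^ (l - 1)) (\<sigma> x) = (\<sigma> ^^ l) x"
      using funpow_Suc_right[of "l - 1" \<sigma>] \<sigma>(3) by (simp del: funpow.simps)
    then have "(\<sigma> ^^ (l - 1)) (\<sigma> x) \<in> P" using \<sigma>(2) x(1) by simp
    ultimately have "\<sigma> x \<in> P" by (rule descend)
    with x(2) show False ..
  qed
  then obtain a where a: "algebraic_int a" "\<sigma> a \<in> P" "a \<notin> P" by blast
  obtain h c where h: "h \<in> P" "algebraic_int c" "1 = h + c * a"
    using alg_maximal_inverse[OF P a(1,3)] .
  have "algebraic_int (c * a)" using h(2) a(1) by (rule algebraic_int_mult)
  moreover have "1 - c * a \<in> P" using h(1,3) by (metis add_diff_cancel_right')
  moreover have "\<sigma> (c * a) \<in> P"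
    unfolding mult[OF \<sigma>(1)] by (rule alg_idealD(4)[OF idP algebraic_int_hom[OF \<sigma>(1) h(2)] a(2)])
  ultimately show ?thesis by blast
qed

text \<open>Multiply the elements obtained for the individual automorphisms that move
  \<open>P\<close>: the product stays congruent to 1 modulo \<open>P\<close>, and each such
  automorphism sends one factor into \<open>P\<close>.\<close>

lemma exists_separating_element:
  assumes exponent: "\<And>\<sigma>. \<sigma> \<in> G \<Longrightarrow> \<sigma> ^^ l = id" and l: "l > 0" and P: "alg_maximal P"
  shows "\<exists>e. algebraic_int e \<and> 1 - e \<in> P \<and> (\<forall>\<sigma>\<in>G. (\<exists>x\<in>P. \<sigma> x \<notin> P) \<longrightarrow> \<sigma> e \<in> P)"
proof -
  have idP: "alg_ideal P" using P by (simp add: alg_maximal_def)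
  have "\<exists>e. algebraic_int e \<and> 1 - e \<in> P \<and> (\<forall>\<sigma>\<in>B. \<sigma> e \<in> P)"
    if "finite B" "B \<subseteq> {\<sigma> \<in> G. \<exists>x\<in>P. \<sigma> x \<notin> P}" for B
    using that
  proof (induction B rule: finite_induct)
    case empty
    show ?case using alg_idealD(5)[OF idP] by (intro exI[of _ 1]) simp
  next
    case (insert \<tau> B)
    then obtain e where e: "algebraic_int e" "1 - e \<in> P" "\<And>\<sigma>. \<sigma> \<in> B \<Longrightarrow> \<sigma> e \<in> P" by blast
    obtain x where \<tau>: "\<tau> \<in> G" and x: "x \<in> P" "\<tau> x \<notin> P" using insert.prems by blast
    obtain d where d: "algebraic_int d" "1 - d \<in> P" "\<tau> d \<in> P"
      using hom_ideal_separation[OF \<tau> exponent[OF \<tau>] l P x] by blast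
    have "(1 - e) + e * (1 - d) \<in> P"
      by (rule alg_idealD(7)[OF idP e(2) alg_idealD(4)[OF idP e(1) d(2)]])
    then have "1 - e * d \<in> P" by (simp add: algebra_simps)
    moreover have "\<sigma> (e * d) \<in> P" if "\<sigma> \<in> insert \<tau> B" for \<sigma>
    proof -
      have \<sigma>: "\<sigma> \<in> G" using that insert.prems by blast
      show ?thesis
      proof (cases "\<sigma> = \<tau>")
        case True
        then show ?thesis
          using alg_idealD(4)[OF idP algebraic_int_hom[OF \<sigma> e(1)] d(3)] by (simp add: mult[OF \<tau>])
      next
        case False
        then have "\<sigma> e \<in> P" using that e(3) by blast
        from alg_idealD(4)[OF idP algebraic_int_hom[OF \<sigma> d(1)] this]
        show ?thesis by (simp add: mult[OF \<sigma>] mult.commute)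
      qed
    qed
    ultimately show ?case using algebraic_int_mult[OF e(1) d(1)] by blast
  qed
  from this[OF finite_subset[OF Collect_restrict finite_G] subset_refl] show ?thesis by blast
qed

lemma hom_power: "\<sigma> \<in> G \<Longrightarrow> \<sigma> (x ^ n) = \<sigma> x ^ n"
  by (induction n) (simp_all add: one mult)

text \<open>The \<open>\<sigma>\<close> from \<open>exists_local_frobenius\<close> depends on \<open>x\<close> and need not map \<open>P\<close> to
  itself. Multiplying \<open>x\<close> by a separating element \<open>e \<equiv> 1\<close> modulo \<open>P\<close> repairs this: if \<open>\<sigma>\<close> does not
  preserve \<open>P\<close>, then \<open>\<sigma> (x * e) \<in> P\<close> and so \<open>x \<in> P\<close>.\<close>

lemma power_exponent_residue:
  fixes x :: 'k
  assumes exponent: "\<And>\<sigma>. \<sigma> \<in> G \<Longrightarrow> \<sigma> ^^ l = id" and l: "l > 0"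
    and p: "prime p" and P: "alg_maximal P" "of_nat p \<in> P" and x: "algebraic_int x"
  shows "x ^ p ^ l - x \<in> P"
proof -
  have idP: "alg_ideal P" "1 \<notin> P" using P(1) by (simp_all add: alg_maximal_def)
  obtain e where e: "algebraic_int e" "1 - e \<in> P"
    "\<And>\<sigma>. \<sigma> \<in> G \<Longrightarrow> \<exists>x\<in>P. \<sigma> x \<notin> P \<Longrightarrow> \<sigma> e \<in> P"
    using exists_separating_element[OF exponent l P(1)] by blast
  define y where "y = x * e"
  have y: "algebraic_int y" using x e(1) by (simp add: y_def algebraic_int_mult)
  have xy: "x - y \<in> P" using alg_idealD(4)[OF idP(1) x e(2)] by (simp add: y_def algebra_simps)
  obtain \<sigma> where \<sigma>: "\<sigma> \<in> G" "y ^ p - \<sigma> y \<in> P" using exists_local_frobenius[OF p P y] by blast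
  have alg\<sigma>: "algebraic_int ((\<sigma> ^^ k) y)" for k
    by (induction k) (simp_all add: y algebraic_int_hom[OF \<sigma>(1)])
  have "y ^ p ^ l - y \<in> P"
  proof (cases "\<exists>x\<in>P. \<sigma> x \<notin> P")
    case True
    have "\<sigma> y \<in> P"
      unfolding y_def mult[OF \<sigma>(1)]
      by (rule alg_idealD(4)[OF idP(1) algebraic_int_hom[OF \<sigma>(1) x] e(3)[OF \<sigma>(1) True]])
    from alg_idealD(7)[OF idP(1) \<sigma>(2) this] have "y ^ p \<in> P" by simp
    have "y \<in> P"
    proof (rule ccontr)
      assume "y \<notin> P"
      have "y ^ n \<notin> P" for n
      proof (induction n)
        case (Suc n)
        then show ?case
          using alg_maximal_prime[OF P(1) y algebraic_int_power[OF y]] \<open>y \<notin> P\<close> by auto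
      qed (simp add: idP)
      with \<open>y ^ p \<in> P\<close> show False by blast
    qed
    moreover have "y ^ p ^ l \<in> P"
    proof -
      have "p ^ l = Suc (p ^ l - 1)" using prime_gt_0_nat[OF p] by simp
      then have "y ^ p ^ l = y ^ (p ^ l - 1) * y" by (metis power_Suc2)
      then show ?thesis using alg_idealD(4)[OF idP(1) algebraic_int_power[OF y] \<open>y \<in> P\<close>] by simp
    qed
    ultimately show ?thesis by (rule alg_idealD(6)[OF idP(1), rotated])
  next
    case False
    \<comment> \<open>Here \<open>\<sigma>\<close> maps \<open>P\<close> into itself, so it may be
      applied to the congruence for \<open>k\<close>; the p^k-th power of
      \<open>y ^ p \<equiv> \<sigma> y\<close> supplies the other half.\<close>
    have "y ^ p ^ k - (\<sigma> ^^ k) y \<in> P" for k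
    proof (induction k)
      case (Suc k)
      have "\<sigma> (y ^ p ^ k - (\<sigma> ^^ k) y) \<in> P" using False Suc by blast
      then have 1: "\<sigma> y ^ p ^ k - \<sigma> ((\<sigma> ^^ k) y) \<in> P"
        by (simp add: hom_diff[OF \<sigma>(1)] hom_power[OF \<sigma>(1)])
      have 2: "(y ^ p) ^ p ^ k - \<sigma> y ^ p ^ k \<in> P"
        by (rule ideal_power_diff[OF idP(1) algebraic_int_power[OF y] algebraic_int_hom[OF \<sigma>(1) y] \<sigma>(2)])
      from alg_idealD(7)[OF idP(1) 2 1] show ?case by (simp add: power_mult)
    qed (simp add: alg_idealD(5)[OF idP(1)])
    from this[of l] show ?thesis by (simp add: exponent[OF \<sigma>(1)])
  qed
  from alg_idealD(7)[OF idP(1) ideal_power_diff[OF idP(1) x y xy, of "p ^ l"] this]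
  have "x ^ p ^ l - y \<in> P" by simp
  from alg_idealD(6)[OF idP(1) this xy] show ?thesis by simp
qed

end

text \<open>Modulo \<open>p ^ f - 1\<close> exponents of \<open>p\<close> may be reduced modulo
  \<open>f\<close>. So \<open>p ^ f - 1\<close> divides \<open>p ^ (l mod f) - 1\<close>, which is
  smaller and therefore zero.\<close>

lemma dvd_if_power_minus_one_dvd:
  fixes p f l :: nat
  assumes p: "p > 1" and f: "f > 0" and dvd: "p ^ f - 1 dvd p ^ l - 1"
  shows "f dvd l"
proof -
  have pos: "1 \<le> p ^ k" for k using p by simp
  have "[p ^ f = 1] (mod (p ^ f - 1))"  by (simp only: cong_altdef_nat[OF pos] dvd_refl)
  then have "[(p ^ f) ^ (l div f) * p ^ (l mod f) = 1 ^ (l div f) * p ^ (l mod f)] (mod (p ^ f - 1))"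
    by (intro cong_mult cong_pow cong_refl)
  then have "[p ^ l = p ^ (l mod f)] (mod (p ^ f - 1))"
    by (simp flip: power_mult power_add)
  moreover have "[p ^ l = 1] (mod (p ^ f - 1))"
    using dvd by (simp only: cong_altdef_nat[OF pos])
  ultimately have "[p ^ (l mod f) = 1] (mod (p ^ f - 1))" using cong_sym cong_trans by blast
  then have "p ^ f - 1 dvd p ^ (l mod f) - 1"
    by (simp only: cong_altdef_nat[OF pos])
  moreover have "p ^ (l mod f) - 1 < p ^ f - 1"
    using p f pos[of "l mod f"] power_strict_increasing[of "l mod f" f p] by (simp add: diff_less_mono)
  ultimately have "p ^ (l mod f) - 1 = 0" using dvd_imp_le by fastforce
  then have "p ^ (l mod f) = 1" using pos[of "l mod f"] by simp
  then have "l mod f = 0" using p by simp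
  then show ?thesis by auto
qed

lemma prime_power_if_unique_prime_factor:
  fixes n p :: nat
  assumes "n > 0" and "\<And>r. prime r \<Longrightarrow> r dvd n \<Longrightarrow> r = p"
  shows "\<exists>f. n = p ^ f"
  using assms
proof (induction n rule: less_induct)
  case (less n)
  show ?case
  proof (cases "n = 1")
    case False
    then obtain r where r: "prime r" "r dvd n" using prime_factor_nat by blast
    then have rp: "r = p" using less.prems(2) by blast
    obtain m where m: "n = r * m" using r(2) ..
    have "m > 0" "m < n" using less.prems(1) m prime_gt_1_nat[OF r(1)] by auto
    moreover have "s = p" if "prime s" "s dvd m" for s using less.prems(2) that m by simp
    ultimately obtain f where "m = p ^ f" using less.IH by blast
    then show ?thesis using m rp by (intro exI[of _ "Suc f"]) simp
  qed (auto intro: exI[of _ 0])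
qed

text \<open>Sylow with exponent 1 serves as Cauchy's theorem: for a prime \<open>r\<close> dividing
  the order, a nontrivial element of a subgroup of order \<open>r\<close> has order dividing both
  \<open>r\<close> and \<open>p\<close>.\<close>

lemma (in Group.group) order_prime_power:
  assumes fin: "finite (carrier G)" and p: "prime p"
    and exponent: "\<And>x. x \<in> carrier G \<Longrightarrow> x [^] p = \<one>"
  shows "\<exists>f. Coset.order G = p ^ f"
proof (rule prime_power_if_unique_prime_factor)
  show "Coset.order G > 0" using fin by (simp add: order_gt_0_iff_finite)
  fix r assume r: "prime r" "r dvd Coset.order G"
  then obtain m where "Coset.order G = r ^ 1 * m" by auto
  then obtain H where H: "subgroup H G" "card H = r"
    using sylow_thm[OF r(1) is_group _ fin, of 1 m] by auto
  have "H \<noteq> {\<one>}" using H(2) prime_gt_1_nat[OF r(1)] by auto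
  then obtain h where h: "h \<in> H" "h \<noteq> \<one>" using subgroup.one_closed[OF H(1)] by blast
  have hG: "h \<in> carrier G" using subgroup.mem_carrier[OF H(1) h(1)] .
  interpret HG: Group.group "G\<lparr>carrier := H\<rparr>" using H(1) by (rule subgroup.subgroup_is_group[OF _ is_group])
  have "h [^]\<^bsub>G\<lparr>carrier := H\<rparr>\<^esub> Coset.order (G\<lparr>carrier := H\<rparr>) = \<one>"
    using HG.pow_order_eq_1[of h] h(1) by simp
  then have "h [^] r = \<one>" using H(2) by (simp add: Coset.order_def nat_pow_consistent[symmetric])
  then have "ord h dvd r" "ord h dvd p" using exponent[OF hG] pow_eq_id[OF hG] by simp_all
  moreover have "ord h \<noteq> 1" using h(2) ord_eq_1[OF hG] by simp
  ultimately show "r = p" using r(1) p by (metis prime_nat_iff)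
qed

section \<open>Residue fields\<close>

lemma ring_of_integers_simps:
  "carrier (ring_of_integers TYPE('k :: field_char_0)) = alg_ints"
  "\<zero>\<^bsub>ring_of_integers TYPE('k)\<^esub> = 0" "\<one>\<^bsub>ring_of_integers TYPE('k)\<^esub> = 1"
  "x \<oplus>\<^bsub>ring_of_integers TYPE('k)\<^esub> y = x + y" "x \<otimes>\<^bsub>ring_of_integers TYPE('k)\<^esub> y = x * y"
  by (simp_all add: ring_of_integers_def ring_of_type_algebra_def)

lemma cring_ring_of_integers: "cring (ring_of_integers TYPE('k :: field_char_0))"
proof (rule cringI)
  have "\<exists>y. algebraic_int y \<and> y + x = 0" if "algebraic_int x" for x :: 'k
    using that by (intro exI[of _ "- x"]) simp
  then show "abelian_group (ring_of_integers TYPE('k))"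
    by (intro abelian_groupI) (auto simp: ring_of_integers_simps algebraic_int_add add.assoc add.commute)
  show "comm_monoid (ring_of_integers TYPE('k))"
    by (intro comm_monoidI) (auto simp: ring_of_integers_simps algebraic_int_mult mult.assoc mult.commute)
qed (simp add: ring_of_integers_simps distrib_right)

lemma minus_ring_of_integers:
  "algebraic_int x \<Longrightarrow> \<ominus>\<^bsub>ring_of_integers TYPE('k :: field_char_0)\<^esub> x = - x"
proof -
  interpret cring "ring_of_integers TYPE('k)" by (rule cring_ring_of_integers)
  assume "algebraic_int x"
  then show ?thesis
    using minus_equality[of "- x" x] by (simp add: ring_of_integers_simps)
qed

lemma ideal_ring_of_integers_iff:
  "ideal I (ring_of_integers TYPE('k :: field_char_0)) \<longleftrightarrow> alg_ideal I"
proof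
  interpret cring "ring_of_integers TYPE('k)" by (rule cring_ring_of_integers)
  assume "ideal I (ring_of_integers TYPE('k))"
  then interpret I: ideal I "ring_of_integers TYPE('k)" .
  have sub: "I \<subseteq> alg_ints" using I.a_subset by (simp add: ring_of_integers_simps)
  have "x - y \<in> I" if "x \<in> I" "y \<in> I" for x y
  proof -
    have "\<ominus>\<^bsub>ring_of_integers TYPE('k)\<^esub> y \<in> I" using that(2) by (rule I.a_inv_closed)
    moreover have "algebraic_int y" using that(2) sub by blast
    ultimately have "- y \<in> I" by (simp only: minus_ring_of_integers)
    from I.a_closed[OF that(1) this] show ?thesis by (simp add: ring_of_integers_simps)
  qed
  moreover have "0 \<in> I" using I.zero_closed by (simp add: ring_of_integers_simps)
  moreover have "a * x \<in> I" if "algebraic_int a" "x \<in> I" for a x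
    using I.I_l_closed[OF that(2), of a] that(1) by (simp add: ring_of_integers_simps)
  ultimately show "alg_ideal I" using sub unfolding alg_ideal_def add_subgroup_def by blast
next
  interpret cring "ring_of_integers TYPE('k)" by (rule cring_ring_of_integers)
  assume I: "alg_ideal I"
  show "ideal I (ring_of_integers TYPE('k))"
  proof (rule idealI)
    show "subgroup I (add_monoid (ring_of_integers TYPE('k)))"
    proof (rule Group.group.subgroupI)
      show "Group.group (add_monoid (ring_of_integers TYPE('k)))" by (rule a_group)
      show "I \<subseteq> carrier (add_monoid (ring_of_integers TYPE('k)))"
        using alg_idealD(2)[OF I] by (simp add: ring_of_integers_simps)
      show "I \<noteq> {}" using alg_idealD(5)[OF I] by blast
      show "inv\<^bsub>add_monoid (ring_of_integers TYPE('k))\<^esub> a \<in> I" if "a \<in> I" for a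
        using minus_ring_of_integers[OF alg_idealD(1)[OF I that]]
          add_subgroupD(3)[OF alg_idealD(3)[OF I] that] by (simp add: a_inv_def)
      show "a \<otimes>\<^bsub>add_monoid (ring_of_integers TYPE('k))\<^esub> b \<in> I" if "a \<in> I" "b \<in> I" for a b
        using alg_idealD(7)[OF I that] by (simp add: ring_of_integers_simps)
    qed
    show "ring (ring_of_integers TYPE('k))" by (rule ring_axioms)
    fix a x assume "a \<in> I" "x \<in> carrier (ring_of_integers TYPE('k))"
    then show "x \<otimes>\<^bsub>ring_of_integers TYPE('k)\<^esub> a \<in> I" "a \<otimes>\<^bsub>ring_of_integers TYPE('k)\<^esub> x \<in> I"
      using alg_idealD(4)[OF I, of x a] by (simp_all add: ring_of_integers_simps mult.commute)
  qed
qed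

lemma a_r_coset_ring_of_integers:
  "I +>\<^bsub>ring_of_integers TYPE('k :: field_char_0)\<^esub> x = (\<lambda>h. h + x) ` I"
  by (auto simp: a_r_coset_def' ring_of_integers_simps)

lemma carrier_Quot_ring_of_integers:
  "carrier (ring_of_integers TYPE('k :: field_char_0) Quot I) = cosets alg_ints I"
  by (auto simp: FactRing_def A_RCOSETS_def' a_r_coset_ring_of_integers cosets_def ring_of_integers_simps)

lemma field_Quot_alg_maximal:
  fixes P :: "'k :: field_char_0 set"
  assumes P: "alg_maximal P"
  shows "Ring.field (ring_of_integers TYPE('k) Quot P)"
proof (rule maximalideal.quotient_is_field[OF _ cring_ring_of_integers])
  show "maximalideal P (ring_of_integers TYPE('k))"
  proof (rule maximalidealI)
    show "ideal P (ring_of_integers TYPE('k))"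
      using P by (simp add: ideal_ring_of_integers_iff alg_maximal_def)
    show "carrier (ring_of_integers TYPE('k)) \<noteq> P"
      using P by (auto simp: ring_of_integers_simps alg_maximal_def)
    fix J assume "ideal J (ring_of_integers TYPE('k))" and sub: "P \<subseteq> J"
    then have J: "alg_ideal J" by (simp add: ideal_ring_of_integers_iff)
    show "J = P \<or> J = carrier (ring_of_integers TYPE('k))"
    proof (cases "1 \<in> J")
      case True
      have "alg_ints \<subseteq> J" using alg_idealD(4)[OF J _ True] by auto
      then show ?thesis using alg_idealD(2)[OF J] by (auto simp: ring_of_integers_simps)
    next
      case False
      then show ?thesis using P J sub by (simp add: alg_maximal_def)
    qed
  qed
qed

lemma Quot_power:
  fixes P :: "'k :: field_char_0 set"
  assumes P: "alg_ideal P" and x: "algebraic_int x"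
  shows "((\<lambda>h. h + x) ` P) [^]\<^bsub>ring_of_integers TYPE('k) Quot P\<^esub> (n :: nat) = (\<lambda>h. h + x ^ n) ` P"
proof -
  interpret ideal P "ring_of_integers TYPE('k)" using P by (simp add: ideal_ring_of_integers_iff)
  show ?thesis
  proof (induction n)
    case 0
    show ?case by (simp add: FactRing_def a_r_coset_ring_of_integers ring_of_integers_simps)
  next
    case (Suc n)
    have "rcoset_mult (ring_of_integers TYPE('k)) P ((\<lambda>h. h + x ^ n) ` P) ((\<lambda>h. h + x) ` P)
        = (\<lambda>h. h + x ^ n * x) ` P"
      using rcoset_mult_add[of "x ^ n" x] x algebraic_int_power[OF x]
      by (simp add: a_r_coset_ring_of_integers ring_of_integers_simps)
    then show ?case using Suc by (simp add: FactRing_def mult.commute)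
  qed
qed

lemma Quot_nsmult:
  fixes P :: "'k :: field_char_0 set"
  assumes P: "alg_ideal P" and x: "algebraic_int x"
  shows "((\<lambda>h. h + x) ` P) [^]\<^bsub>add_monoid (ring_of_integers TYPE('k) Quot P)\<^esub> (n :: nat)
    = (\<lambda>h. h + of_nat n * x) ` P"
proof -
  interpret ideal P "ring_of_integers TYPE('k)" using P by (simp add: ideal_ring_of_integers_iff)
  show ?thesis
  proof (induction n)
    case 0
    show ?case by (simp add: FactRing_def)
  next
    case (Suc n)
    have "((\<lambda>h. h + of_nat n * x) ` P) <+>\<^bsub>ring_of_integers TYPE('k)\<^esub> ((\<lambda>h. h + x) ` P)
        = (\<lambda>h. h + (of_nat n * x + x)) ` P"
      using a_rcos_sum[of "of_nat n * x" x] x algebraic_int_mult[OF algebraic_int_of_nat x]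
      by (simp add: a_r_coset_ring_of_integers ring_of_integers_simps)
    then show ?case using Suc by (simp add: FactRing_def distrib_right add.commute)
  qed
qed

text \<open>The additive group is killed by \<open>p\<close>, so its order is \<open>p ^ f\<close>.
  The multiplicative group is cyclic, and its generator \<open>g\<close>, of order
  \<open>p ^ f - 1\<close>, satisfies \<open>residue\<close>; hence \<open>p ^ f - 1\<close> divides
  \<open>p ^ l - 1\<close>.\<close>

lemma card_residue_field:
  fixes P :: "'k :: field_char_0 set"
  assumes fin: "finite (cosets alg_ints P)" and p: "prime p"
    and P: "alg_maximal P" "of_nat p \<in> P" and l: "l > 0"
    and residue: "\<And>x. algebraic_int x \<Longrightarrow> x ^ p ^ l - x \<in> P"
  shows "\<exists>f. f dvd l \<and> card (cosets alg_ints P) = p ^ f"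
proof -
  let ?R = "ring_of_integers TYPE('k) Quot P"
  have idP: "alg_ideal P" using P(1) by (simp add: alg_maximal_def)
  note grP = alg_idealD(3)[OF idP]
  interpret R: Ring.field ?R using P(1) by (rule field_Quot_alg_maximal)
  have carrier: "carrier ?R = cosets alg_ints P" by (rule carrier_Quot_ring_of_integers)
  have zero: "\<zero>\<^bsub>?R\<^esub> = P" by (simp add: FactRing_def)
  have "x [^]\<^bsub>add_monoid ?R\<^esub> p = \<one>\<^bsub>add_monoid ?R\<^esub>" if "x \<in> carrier (add_monoid ?R)" for x
  proof -
    obtain a where a: "algebraic_int a" "x = (\<lambda>h. h + a) ` P"
      using \<open>x \<in> carrier (add_monoid ?R)\<close> by (auto simp: carrier cosets_def)
    have "of_nat p * a - 0 \<in> P" using alg_idealD(4)[OF idP a(1) P(2)] by (simp add: mult.commute)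
    then have "(\<lambda>h. h + of_nat p * a) ` P = (\<lambda>h. h + 0) ` P" by (simp only: coset_eq_iff[OF grP])
    then show ?thesis unfolding a(2) Quot_nsmult[OF idP a(1)] using zero by simp
  qed
  then have "\<exists>f. Coset.order (add_monoid ?R) = p ^ f"
    using fin p by (intro group.order_prime_power[OF R.a_group]) (simp_all add: carrier)
  then obtain f where f: "card (cosets alg_ints P) = p ^ f" by (auto simp: Coset.order_def carrier)
  interpret M: Group.group "Multiplicative_Group.mult_of ?R" by (rule R.field_mult_group)
  obtain g where g: "g \<in> carrier (Multiplicative_Group.mult_of ?R)" "carrier (Multiplicative_Group.mult_of ?R) = {g [^]\<^bsub>?R\<^esub> i | i :: nat. i \<in> UNIV}"
    using R.finite_field_mult_group_has_gen fin unfolding carrier by blast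
  have finM: "finite (carrier (Multiplicative_Group.mult_of ?R))" using fin by (simp add: carrier)
  have "M.ord g = Coset.order (Multiplicative_Group.mult_of ?R)"
  proof -
    have "carrier (Multiplicative_Group.mult_of ?R) = generate (Multiplicative_Group.mult_of ?R) {g}"
      unfolding M.generate_pow_on_finite_carrier[OF finM g(1)] g(2) by (simp add: Multiplicative_Group.nat_pow_mult_of)
    then show ?thesis using M.generate_pow_card[OF g(1)] by (simp add: Coset.order_def)
  qed
  then have ord: "M.ord g = p ^ f - 1"
    using R.order_mult_of fin f by (simp add: carrier Coset.order_def)
  obtain a where a: "algebraic_int a" "g = (\<lambda>h. h + a) ` P"
    using g(1) by (auto simp: carrier cosets_def)
  have "g [^]\<^bsub>?R\<^esub> (p ^ l) = g"
    using residue[OF a(1)] by (simp add: a(2) Quot_power[OF idP a(1)] coset_eq_iff[OF grP])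
  \<comment> \<open>\<open>N\<close> is \<open>p ^ l - 1\<close>; the successor form lets one factor
    \<open>g\<close> be cancelled.\<close>
  moreover obtain N where N: "p ^ l = Suc N"
    using prime_gt_0_nat[OF p] by (metis gr0_implies_Suc zero_less_power)
  ultimately have "g [^]\<^bsub>Multiplicative_Group.mult_of ?R\<^esub> Suc N = g"
    by (simp only: Multiplicative_Group.nat_pow_mult_of)
  then have "g [^]\<^bsub>Multiplicative_Group.mult_of ?R\<^esub> N \<otimes>\<^bsub>Multiplicative_Group.mult_of ?R\<^esub> g = g" by (simp only: M.nat_pow_Suc)
  then have "g [^]\<^bsub>Multiplicative_Group.mult_of ?R\<^esub> N = \<one>\<^bsub>Multiplicative_Group.mult_of ?R\<^esub>"
    by (simp only: M.r_cancel_one[OF g(1) M.nat_pow_closed[OF g(1)]])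
  then have "M.ord g dvd N" by (simp only: M.pow_eq_id[OF g(1)])
  then have dvd: "p ^ f - 1 dvd p ^ l - 1" by (simp add: ord N)
  have "f > 0"
  proof (rule ccontr)
    assume "\<not> f > 0"
    then have "card (carrier ?R) = 1" using f carrier by simp
    then show False using R.one_not_zero by (metis R.one_closed R.zero_closed card_1_singletonE singletonD)
  qed
  then show ?thesis using dvd_if_power_minus_one_dvd[OF prime_gt_1_nat[OF p] _ dvd] f by blast
qed

section \<open>The Galois group\<close>

lemma mem_galois_group_iff:
  "\<sigma> \<in> carrier (galois_group TYPE('k :: field_char_0)) \<longleftrightarrow>
     bij \<sigma> \<and> (\<forall>x y. \<sigma> (x + y) = \<sigma> x + \<sigma> y) \<and> (\<forall>x y. \<sigma> (x * y) = \<sigma> x * \<sigma> y) \<and>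
     \<sigma> 1 = 1 \<and> (\<forall>q\<in>\<rat>. \<sigma> q = q)"
  by (auto simp: galois_group_def ring_iso_def Ring.ring_hom_def ring_of_type_algebra_def)

lemma galois_group_simps:
  "\<sigma> \<otimes>\<^bsub>galois_group TYPE('k :: field_char_0)\<^esub> \<tau> = \<sigma> \<circ> \<tau>" "\<one>\<^bsub>galois_group TYPE('k)\<^esub> = id"
  by (simp_all add: galois_group_def)

lemma id_mem_galois_group: "id \<in> carrier (galois_group TYPE('k :: field_char_0))"
  by (simp add: mem_galois_group_iff)

lemma comp_mem_galois_group:
  assumes "\<sigma> \<in> carrier (galois_group TYPE('k :: field_char_0))" "\<tau> \<in> carrier (galois_group TYPE('k))"
  shows "\<sigma> \<circ> \<tau> \<in> carrier (galois_group TYPE('k))"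
  using assms by (auto simp: mem_galois_group_iff intro: bij_comp)

lemma nat_pow_DirProd: "(a, b) [^]\<^bsub>G \<times>\<times> H\<^esub> (n :: nat) = (a [^]\<^bsub>G\<^esub> n, b [^]\<^bsub>H\<^esub> n)"
  by (induction n) simp_all

lemma galois_group_exponent:
  assumes H: "Group.group H" and exponent: "\<And>x. x \<in> carrier H \<Longrightarrow> x [^]\<^bsub>H\<^esub> (l :: nat) = \<one>\<^bsub>H\<^esub>"
    and iso: "galois_group TYPE('k :: field_char_0) \<cong> H"
    and \<sigma>: "\<sigma> \<in> carrier (galois_group TYPE('k))"
  shows "\<sigma> ^^ l = id"
proof -
  let ?G = "carrier (galois_group TYPE('k))"
  interpret H: Group.group H by (rule H)
  obtain h where bij: "bij_betw h ?G (carrier H)"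
      and hom: "\<And>\<sigma> \<tau>. \<sigma> \<in> ?G \<Longrightarrow> \<tau> \<in> ?G \<Longrightarrow> h (\<sigma> \<circ> \<tau>) = h \<sigma> \<otimes>\<^bsub>H\<^esub> h \<tau>"
    using iso by (auto simp: is_iso_def Group.iso_def Group.hom_def galois_group_simps)
  have closed: "h \<tau> \<in> carrier H" if "\<tau> \<in> ?G" for \<tau> using bij_betw_apply[OF bij that] .
  \<comment> \<open>An idempotent of a group is its identity; this uses the group laws of
    \<open>H\<close> alone.\<close>
  have "h id \<otimes>\<^bsub>H\<^esub> h id = h id" using hom[OF id_mem_galois_group id_mem_galois_group] by simp
  then have h_id: "h id = \<one>\<^bsub>H\<^esub>" using closed[OF id_mem_galois_group] by simp
  have pow: "\<sigma> ^^ n \<in> ?G \<and> h (\<sigma> ^^ n) = h \<sigma> [^]\<^bsub>H\<^esub> n" for n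
  proof (induction n)
    case 0
    show ?case by (simp only: funpow.simps H.nat_pow_0 h_id id_mem_galois_group simp_thms)
  next
    case (Suc n)
    then show ?case
      using comp_mem_galois_group[of "\<sigma> ^^ n" \<sigma>] hom[of "\<sigma> ^^ n" \<sigma>] \<sigma>
      by (simp only: funpow_Suc_right H.nat_pow_Suc simp_thms)
  qed
  have "h (\<sigma> ^^ l) = h id" using pow exponent[OF closed[OF \<sigma>]] h_id by simp
  then show ?thesis
    using inj_onD[OF bij_betw_imp_inj_on[OF bij] _ conjunct1[OF pow] id_mem_galois_group] by blast
qed

lemma galois_action_galois_group:
  assumes "galois_over_rat TYPE('k :: field_char_0)" "finite (carrier (galois_group TYPE('k)))"
  shows "galois_action (carrier (galois_group TYPE('k)))"
proof
  let ?G = "carrier (galois_group TYPE('k))"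
  show "finite ?G" by fact
  show "id \<in> ?G" by (rule id_mem_galois_group)
  show "\<sigma> \<circ> \<tau> \<in> ?G" if "\<sigma> \<in> ?G" "\<tau> \<in> ?G" for \<sigma> \<tau>
    using that by (rule comp_mem_galois_group)
  show "\<sigma> (x + y) = \<sigma> x + \<sigma> y" "\<sigma> (x * y) = \<sigma> x * \<sigma> y" "\<sigma> 1 = 1" if "\<sigma> \<in> ?G" for \<sigma> x y
    using that by (simp_all add: mem_galois_group_iff)
  show "x \<in> \<rat>" if "\<forall>\<sigma>\<in>?G. \<sigma> x = x" for x
    using assms(1) that unfolding galois_over_rat_def by blast
qed

section \<open>Finitely many ideals of each index, and the conclusion\<close>

lemma ideal_index_eq: "ideal_index TYPE('k :: field_char_0) I = card (cosets alg_ints I)"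
  by (simp add: ideal_index_def carrier_Quot_ring_of_integers)

text \<open>Two of the n + 1 integers 0, ..., n share one of the n cosets, and their difference,
  between 1 and n, divides n!.\<close>

lemma fact_mem_ideal:
  fixes I :: "'k :: field_char_0 set"
  assumes I: "alg_ideal I" and n: "card (cosets alg_ints I) = n" "n > 0"
  shows "of_nat (fact n) \<in> I"
proof -
  let ?c = "\<lambda>k :: nat. (\<lambda>h. h + of_nat k) ` I"
  have "finite (cosets alg_ints I)" using n card_gt_0_iff by blast
  moreover have "?c ` {..n} \<subseteq> cosets alg_ints I" by (auto intro!: coset_mem_cosets)
  ultimately have "card (?c ` {..n}) \<le> n" using card_mono n(1) by blast
  then have "\<not> inj_on ?c {..n}" by (auto dest: card_image)
  then obtain i j where ij: "i \<le> n" "j < i" "?c i = ?c j"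
    unfolding inj_on_def by (metis atMost_iff linorder_neqE_nat)
  then have "of_nat i - of_nat j \<in> I" by (simp add: coset_eq_iff[OF alg_idealD(3)[OF I]])
  then have ijI: "of_nat (i - j) \<in> I" using ij(2) by (simp add: of_nat_diff)
  have "i - j dvd fact n" using ij by (intro dvd_fact) auto
  then obtain k where "fact n = (i - j) * k" ..
  then have "of_nat (fact n) = of_nat k * (of_nat (i - j) :: 'k)" by (simp add: mult.commute flip: of_nat_mult)
  also have "\<dots> \<in> I" by (rule alg_idealD(4)[OF I algebraic_int_of_nat ijI])
  finally show ?thesis .
qed

lemma finite_ideals_of_index:
  assumes "number_field TYPE('k :: field_char_0)" "n > 0"
  shows "finite {I :: 'k set. alg_ideal I \<and> card (cosets alg_ints I) = n}"
proof (rule finite_subset[OF _ finite_ideals_containing[OF assms(1)]])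
  show "{I :: 'k set. alg_ideal I \<and> card (cosets alg_ints I) = n} \<subseteq> {I. alg_ideal I \<and> of_nat (fact n) \<in> I}"
    using fact_mem_ideal assms(2) by blast
  show "(fact n :: nat) > 0" by simp
qed

theorem theorem3p22:
  fixes l :: nat
  assumes "prime l"
    and "number_field TYPE('k::field_char_0)"
    and "galois_over_rat TYPE('k)"
    and "degree_over_rat TYPE('k) = l ^ 3"
    and "galois_group TYPE('k) \<cong>
           integer_mod_group l \<times>\<times> integer_mod_group l \<times>\<times> integer_mod_group l"
  shows "\<forall>(p::nat) (b::nat). prime p \<and> b \<ge> 1 \<longrightarrow> ideal_count TYPE('k) (p ^ (b * l)) \<noteq> 0"
proof (intro allI impI, elim conjE)
  fix p b :: nat
  assume p: "prime p" and "b \<ge> 1"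
  note K = assms(2)
  have l: "l > 0" using assms(1) by (rule prime_gt_0_nat)
  have p0: "p > 0" using p by (rule prime_gt_0_nat)
  let ?G = "carrier (galois_group TYPE('k))"
  let ?H = "integer_mod_group l \<times>\<times> integer_mod_group l \<times>\<times> integer_mod_group l"
  have H: "Group.group ?H" by (intro DirProd_group group_integer_mod_group)
  \<comment> \<open>In each cyclic factor the power is a multiple of \<open>l\<close>, hence zero
    modulo \<open>l\<close>.\<close>
  have exponent: "x [^]\<^bsub>?H\<^esub> l = \<one>\<^bsub>?H\<^esub>" if "x \<in> carrier ?H" for x
    by (cases x) (simp add: nat_pow_DirProd)
  have "finite ?G"
  proof -
    obtain h where "bij_betw h ?G (carrier ?H)"
      using assms(5) by (auto simp: is_iso_def Group.iso_def)
    moreover have "finite (carrier (integer_mod_group l))" using l by (simp add: carrier_integer_mod_group)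
    ultimately show ?thesis by (simp add: bij_betw_finite)
  qed
  then interpret galois_action ?G using assms(3) by (intro galois_action_galois_group)
  obtain P :: "'k set" where P: "alg_maximal P" "of_nat p \<in> P"
    using exists_alg_maximal[OF K p] by blast
  have idP: "alg_ideal P" using P(1) by (simp add: alg_maximal_def)
  obtain f where f: "f dvd l" "card (cosets alg_ints P) = p ^ f"
    using card_residue_field[OF finite_cosets_ideal[OF K p0 idP P(2)] p P l]
      power_exponent_residue[OF galois_group_exponent[OF H exponent assms(5)] l p P] by blast
  \<comment> \<open>Since \<open>f\<close> divides \<open>l\<close>, this choice makes
    \<open>f * m\<close> equal to \<open>b * l\<close>, so an ideal of index
    \<open>(p ^ f) ^ m\<close> has the required index.\<close>
  define m where "m = b * (l div f)"
  have fm: "f * m = b * l" using f(1) by (auto simp: m_def)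
  obtain I :: "'k set" where I: "alg_ideal I" "of_nat (p ^ m) \<in> I"
    "card (cosets alg_ints I) = card (cosets alg_ints P) ^ m"
    using exists_ideal_index_power[OF K p0 P] by blast
  let ?S = "{I. ideal I (ring_of_integers TYPE('k)) \<and> I \<noteq> {\<zero>\<^bsub>ring_of_integers TYPE('k)\<^esub>} \<and>
    ideal_index TYPE('k) I = p ^ (b * l)}"
  have "card (cosets alg_ints I) = p ^ (b * l)"
    by (simp add: I(3) f(2) fm flip: power_mult)
  moreover have "I \<noteq> {0}" using I(2) p0 by auto
  ultimately have "I \<in> ?S"
    using I(1) by (simp add: ideal_index_eq ideal_ring_of_integers_iff ring_of_integers_simps)
  \<comment> \<open>Needed because \<open>card\<close> of an infinite set would be 0.\<close>
  moreover have "finite ?S"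
    by (rule finite_subset[OF _ finite_ideals_of_index[OF K, of "p ^ (b * l)"]])
      (use p0 in \<open>auto simp: ideal_index_eq ideal_ring_of_integers_iff\<close>)
  ultimately show "ideal_count TYPE('k) (p ^ (b * l)) \<noteq> 0"
    unfolding ideal_count_def by (metis card_0_eq empty_iff)
qed

end
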